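(* Let $\mathcal{H}$ be an infinite-dimensional separable complex Hilbert space and let $T$ be a hyponormal bounded linear operator on $\mathcal{H}$ that is not a scalar multiple of the identity. Assume that there exist an orthonormal basis $\{e_n\}_{n\in\mathbb{N}}$ of $\mathcal{H}$ and some $n_0\in\mathbb{N}$ such that $$\langle T e_n,e_{n+\ell}\rangle=\langle T^{*}e_n,e_{n+\ell}\rangle=0$$ for every $\ell\geq 2$ and every $n\geq n_0$. Then $T$ has a nontrivial closed hyperinvariant subspace.
   Context: A bounded operator $T$ is hyponormal if $[T^*,T]=T^*T-TT^*$ is positive semi-definite. A closed subspace $M$ is hyperinvariant for $T$ if it is invariant under every bounded operator commuting with $T$; it is nontrivial if $M\neq\{0\}$ and $M\neq\mathcal{H}$. *)

theory Defs
  imports "HOL-Analysis.Analysis"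
begin

section \<open>Complex Hilbert spaces\<close>

class complex_vector = real_vector +
  fixes scaleC :: "complex \<Rightarrow> 'a \<Rightarrow> 'a"  (infixr \<open>*\<^sub>C\<close> 75)
  assumes scaleC_add_right: "a *\<^sub>C (x + y) = a *\<^sub>C x + a *\<^sub>C y"
    and scaleC_add_left: "(a + b) *\<^sub>C x = a *\<^sub>C x + b *\<^sub>C x"
    and scaleC_scaleC: "a *\<^sub>C b *\<^sub>C x = (a * b) *\<^sub>C x"
    and scaleC_of_real: "complex_of_real r *\<^sub>C x = r *\<^sub>R x"

global_interpretation complex_vector: vector_space "scaleC :: complex \<Rightarrow> 'a \<Rightarrow> 'a :: complex_vector"
  defines csubspace_raw_def: csubspace = complex_vector.subspace
    and cspan_raw_def: cspan = complex_vector.span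
proof unfold_locales
  show "1 *\<^sub>C x = x" for x :: 'a
    using scaleC_of_real[of 1 x] by simp
qed (simp_all add: scaleC_add_right scaleC_add_left scaleC_scaleC)

text \<open>The inner product is linear in its first argument and conjugate-linear in its second.
  The norm (and with it the metric and the topology) is the one induced by the inner product.\<close>

class complex_inner = complex_vector + real_normed_vector +
  fixes cinner :: "'a \<Rightarrow> 'a \<Rightarrow> complex"
  assumes cinner_commute: "cinner x y = cnj (cinner y x)"
    and cinner_add_left: "cinner (x + y) z = cinner x z + cinner y z"
    and cinner_scaleC_left: "cinner (c *\<^sub>C x) y = c * cinner x y"
    and cinner_self: "cinner x x = complex_of_real ((norm x)\<^sup>2)"

class chilbert_space = complex_inner + complete_space

definition orthonormal_basis :: "(nat \<Rightarrow> 'a::complex_inner) \<Rightarrow> bool" where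
  "orthonormal_basis e \<longleftrightarrow>
     (\<forall>m n. cinner (e m) (e n) = (if m = n then 1 else 0)) \<and> closure (cspan (range e)) = UNIV"

definition cinfinite_dimensional :: "'a::complex_vector itself \<Rightarrow> bool" where
  "cinfinite_dimensional _ \<longleftrightarrow> \<not> (\<exists>B :: 'a set. finite B \<and> cspan B = UNIV)"


section \<open>Bounded operators\<close>

definition bounded_clinear :: "('a::complex_inner \<Rightarrow> 'b::complex_inner) \<Rightarrow> bool" where
  "bounded_clinear T \<longleftrightarrow> bounded_linear T \<and> (\<forall>c x. T (c *\<^sub>C x) = c *\<^sub>C T x)"

text \<open>On a Hilbert space the adjoint of a bounded operator exists and is unique;
  see \<open>cinner_cadjoint\<close> and \<open>cadjoint_unique\<close> below.\<close>

definition cadjoint :: "('a::complex_inner \<Rightarrow> 'b::complex_inner) \<Rightarrow> 'b \<Rightarrow> 'a" where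
  "cadjoint T = (THE S. \<forall>x y. cinner (T x) y = cinner x (S y))"

definition positive_semidefinite :: "('a::complex_inner \<Rightarrow> 'a) \<Rightarrow> bool" where
  "positive_semidefinite A \<longleftrightarrow> (\<forall>x. cinner (A x) x \<in> \<real>\<^sub>\<ge>\<^sub>0)"

definition hyponormal :: "('a::complex_inner \<Rightarrow> 'a) \<Rightarrow> bool" where
  "hyponormal T \<longleftrightarrow> positive_semidefinite (\<lambda>x. cadjoint T (T x) - T (cadjoint T x))"

definition hyperinvariant :: "('a::complex_inner \<Rightarrow> 'a) \<Rightarrow> 'a set \<Rightarrow> bool" where
  "hyperinvariant T M \<longleftrightarrow> (\<forall>S. bounded_clinear S \<and> S \<circ> T = T \<circ> S \<longrightarrow> S ` M \<subseteq> M)"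


section \<open>Well-definedness of the adjoint\<close>

lemma cinner_add_right: "cinner x (y + z) = cinner x y + cinner x z"
  by (metis cinner_commute cinner_add_left complex_cnj_add)

lemma cinner_scaleC_right: "cinner x (c *\<^sub>C y) = cnj c * cinner x y"
  by (metis cinner_commute cinner_scaleC_left complex_cnj_mult)

lemma cinner_scaleR_left: "cinner (r *\<^sub>R x) y = of_real r * cinner x y"
  by (metis cinner_scaleC_left scaleC_of_real)

lemma cinner_scaleR_right: "cinner x (r *\<^sub>R y) = of_real r * cinner x y"
  by (metis cinner_scaleC_right scaleC_of_real complex_cnj_complex_of_real)

lemma cinner_diff_right: "cinner x (y - z) = cinner x y - cinner x z"
  using cinner_add_right[of x "y - z" z] by simp

lemma norm_add_sq: "(norm (x + y))\<^sup>2 = (norm x)\<^sup>2 + (norm y)\<^sup>2 + 2 * Re (cinner x y)"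
proof -
  have "complex_of_real ((norm (x + y))\<^sup>2) = cinner (x + y) (x + y)"
    by (simp only: cinner_self)
  also have "\<dots> = cinner x x + cinner y y + (cinner x y + cnj (cinner x y))"
    using cinner_commute[of y x] by (simp add: cinner_add_left cinner_add_right)
  also have "\<dots> = of_real ((norm x)\<^sup>2 + (norm y)\<^sup>2 + 2 * Re (cinner x y))"
    by (simp only: cinner_self complex_add_cnj of_real_add)
  finally show ?thesis
    using of_real_eq_iff by blast
qed

lemma Re_cinner_le: "Re (cinner x y) \<le> norm x * norm y"
proof -
  have "(norm (x + y))\<^sup>2 \<le> (norm x + norm y)\<^sup>2"
    by (rule power_mono[OF norm_triangle_ineq]) simp
  then show ?thesis
    unfolding norm_add_sq by (simp add: power2_sum)
qed

lemma riesz_real: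
  fixes g :: "'a::chilbert_space \<Rightarrow> real"
  assumes "bounded_linear g"
  shows "\<exists>w. \<forall>z. Re (cinner z w) = g z"
proof -
  interpret g: bounded_linear g by fact
  obtain L where L: "\<And>z. norm (g z) \<le> norm z * L" "L \<ge> 0"
    using g.nonneg_bounded by blast
  define F where "F z = (norm z)\<^sup>2 - 2 * g z" for z
  have lower: "F z \<ge> - L\<^sup>2" for z
  proof -
    have "(norm z - L)\<^sup>2 \<ge> 0" by simp
    then have "(norm z)\<^sup>2 + L\<^sup>2 \<ge> 2 * (norm z * L)" by (simp add: power2_diff)
    moreover have "g z \<le> norm z * L" using L(1)[of z] by simp
    ultimately show ?thesis unfolding F_def by linarith
  qed
  define m where "m = Inf (range F)"
  have bdd: "bdd_below (range F)" using lower by (auto intro!: bdd_belowI)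
  have mle: "m \<le> F z" for z unfolding m_def by (rule cInf_lower[OF _ bdd]) simp
  have "\<exists>z. F z < m + inverse (real (Suc n))" for n
    using cInf_lessD[of "range F" "m + inverse (real (Suc n))"] unfolding m_def by auto
  then obtain u where u: "\<And>n. F (u n) < m + inverse (real (Suc n))" by metis
  have par: "(norm (a - b))\<^sup>2 = 2 * F a + 2 * F b - 4 * F ((1/2) *\<^sub>R (a + b))" for a b
  proof -
    have "norm ((1/2) *\<^sub>R (a + b)) = norm (a + b) / 2" by simp
    then have "(norm ((1/2) *\<^sub>R (a + b)))\<^sup>2 = (norm (a + b))\<^sup>2 / 4"
      by (simp add: power_divide)
    moreover have "g ((1/2) *\<^sub>R (a + b)) = (g a + g b) / 2"
      by (simp add: g.scaleR g.add)
    moreover have "(norm (a - b))\<^sup>2 = (norm a)\<^sup>2 + (norm b)\<^sup>2 - 2 * Re (cinner a b)"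
      using norm_add_sq[of a "- b"] cinner_scaleR_right[of a "-1" b] by simp
    ultimately show ?thesis
      using norm_add_sq[of a b] unfolding F_def by argo
  qed
  have dist: "(norm (u i - u j))\<^sup>2 \<le> 2 * inverse (real (Suc i)) + 2 * inverse (real (Suc j))" for i j
    using par[of "u i" "u j"] u[of i] u[of j] mle[of "(1/2) *\<^sub>R (u i + u j)"] by linarith
  have "Cauchy u"
  proof (rule CauchyI)
    fix r :: real assume "0 < r"
    then obtain N where N: "inverse (real (Suc N)) < r\<^sup>2 / 4"
      using reals_Archimedean[of "r\<^sup>2 / 4"] by auto
    have "norm (u i - u j) < r" if "i \<ge> N" "j \<ge> N" for i j
    proof -
      have "inverse (real (Suc i)) \<le> inverse (real (Suc N))" 
        "inverse (real (Suc j)) \<le> inverse (real (Suc N))"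
        using that by (auto intro!: le_imp_inverse_le)
      then have "(norm (u i - u j))\<^sup>2 < r\<^sup>2" using dist[of i j] N by linarith
      then show ?thesis using \<open>0 < r\<close> by (simp add: power_less_imp_less_base)
    qed
    then show "\<exists>M. \<forall>i\<ge>M. \<forall>j\<ge>M. norm (u i - u j) < r" by blast
  qed
  then obtain w where w: "u \<longlonglongrightarrow> w" using Cauchy_convergent convergent_def by blast
  have "(\<lambda>n. F (u n)) \<longlonglongrightarrow> F w"
    unfolding F_def by (intro tendsto_intros w g.tendsto)
  moreover have "(\<lambda>n. m + inverse (real (Suc n))) \<longlonglongrightarrow> m + 0"
    by (intro tendsto_intros LIMSEQ_inverse_real_of_nat)
  ultimately have "F w \<le> m + 0"
    using u by (intro LIMSEQ_le) (auto intro: less_imp_le)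
  then have min: "F w \<le> F z" for z using mle[of z] by simp
  have "Re (cinner w z) = g z" for z
  proof -
    define d where "d = Re (cinner w z) - g z"
    have quad: "0 \<le> t\<^sup>2 * (norm z)\<^sup>2 + 2 * (t * d)" for t
      using min[of "w + t *\<^sub>R z"] norm_add_sq[of w "t *\<^sub>R z"]
      by (simp add: F_def d_def g.add g.scaleR cinner_scaleR_right power_mult_distrib algebra_simps)
    define s where "s = 1 + (norm z)\<^sup>2"
    have s: "s > 0" unfolding s_def by (simp add: add_pos_nonneg)
    have "0 \<le> (- d / s)\<^sup>2 * (norm z)\<^sup>2 + 2 * ((- d / s) * d)" by (rule quad)
    also have "\<dots> \<le> (- d / s)\<^sup>2 * s + 2 * ((- d / s) * d)"
      unfolding s_def by (intro add_right_mono mult_left_mono) auto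
    also have "\<dots> = - (d\<^sup>2 / s)" using s by (simp add: power2_eq_square field_simps)
    finally have "d\<^sup>2 \<le> 0" using s by (simp add: zero_le_divide_iff divide_le_0_iff)
    then show ?thesis by (simp add: d_def)
  qed
  then show ?thesis by (metis cinner_commute complex_cnj(1) cnj.simps(1))
qed

lemma cadjoint_unique:
  assumes "\<And>x y. cinner (T x) y = cinner x (S y)"
  shows "cadjoint T = S"
  unfolding cadjoint_def
proof (rule the_equality)
  fix S' assume S': "\<forall>x y. cinner (T x) y = cinner x (S' y)"
  have "S' y = S y" for y
  proof -
    have "cinner (S' y - S y) (S' y - S y) = 0"
      unfolding cinner_diff_right[of "S' y - S y"] using S' assms by simp
    then show ?thesis by (simp add: cinner_self)
  qed
  then show "S' = S" by auto
qed (use assms in auto)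

lemma cinner_cadjoint:
  fixes T :: "'a::chilbert_space \<Rightarrow> 'b::complex_inner"
  assumes "bounded_clinear T"
  shows "cinner (T x) y = cinner x (cadjoint T y)"
proof -
  interpret T: bounded_linear T using assms by (simp add: bounded_clinear_def)
  have TC: "T (c *\<^sub>C x) = c *\<^sub>C T x" for c x using assms by (simp add: bounded_clinear_def)
  have "\<exists>w. \<forall>z. cinner (T z) y = cinner z w" for y
  proof -
    obtain K where K: "\<And>x. norm (T x) \<le> norm x * K" using T.bounded by blast
    have "bounded_linear (\<lambda>z. Re (cinner (T z) y))"
    proof (rule bounded_linear_intro[where K = "K * norm y"])
      fix z
      have 1: "Re (cinner (T z) y) \<le> norm (T z) * norm y" by (rule Re_cinner_le)
      have 2: "- Re (cinner (T z) y) \<le> norm (T z) * norm y"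
        using Re_cinner_le[of "- T z" y] cinner_scaleR_left[of "-1" "T z" y] by simp
      have "norm (T z) * norm y \<le> (norm z * K) * norm y"
        by (intro mult_right_mono K) simp
      with 1 2 show "norm (Re (cinner (T z) y)) \<le> norm z * (K * norm y)"
        by (simp add: mult.assoc)
    qed (simp_all add: T.add T.scaleR cinner_add_left cinner_scaleR_left)
    from riesz_real[OF this] obtain w where w: "\<And>z. Re (cinner z w) = Re (cinner (T z) y)" by blast
    have "cinner (T z) y = cinner z w" for z
      using w[of z] w[of "\<i> *\<^sub>C z"] by (simp add: TC cinner_scaleC_left complex_eq_iff)
    then show ?thesis by blast
  qed
  then obtain S where S: "\<And>x y. cinner (T x) y = cinner x (S y)" by metis
  then show ?thesis using cadjoint_unique[of T S] by simp
qed

end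

theory Submission
  imports Defs
begin

text \<open>Write \<open>t j k = \<langle>T e\<^sub>k, e\<^sub>j\<rangle>\<close> and \<open>D = T\<^sup>* T - T T\<^sup>* \<ge> 0\<close>. Because \<open>T\<close> is tridiagonal outside the first
  \<open>n0\<close> rows and columns, the partial traces of \<open>D\<close> differ from
  \<open>|t (n + 1) n|\<^sup>2 - |t n (n + 1)|\<^sup>2\<close> by a null sequence; hence \<open>D\<close> has a finite trace \<open>\<delta>\<close>, the limit of
  these differences.

  If \<open>\<delta> = 0\<close> then \<open>T\<close> is normal. For \<open>N = T - d\<close> and \<open>c > 0\<close> the set of all \<open>x\<close> with
  \<open>\<parallel>N\<^sup>n x\<parallel> \<le> c\<^sup>n \<parallel>x\<parallel>\<close> for every \<open>n\<close> is a closed hyperinvariant subspace, which is nontrivial as soon as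
  \<open>\<parallel>N w\<parallel> < c < \<parallel>N v\<parallel>\<close> for some unit vectors \<open>v\<close>, \<open>w\<close>. If such \<open>d\<close>, \<open>c\<close> did not exist, the quadratic
  form of \<open>T\<close> would be constant on unit vectors and \<open>T\<close> would be scalar.

  If \<open>\<delta> > 0\<close>, the summability of the entries of \<open>D\<close> near the diagonal forces \<open>t n n\<close> to converge to some
  \<open>d\<close> and \<open>|t n (n + 1)|\<^sup>2 - |t (n + 2) (n + 1)|\<^sup>2\<close> to tend to \<open>-\<delta>\<close>: up to a compact perturbation \<open>T - d\<close>
  is a Toeplitz operator of index \<open>-1\<close>. Accordingly \<open>T\<^sup>*\<close> has an eigenvector for the conjugate of \<open>d\<close>,
  found by solving a recurrence, and the closure of the range of \<open>T - d\<close> is a nontrivial hyperinvariant subspace.\<close>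

instance chilbert_space \<subseteq> banach ..

section \<open>Inner products, bounded operators and adjoints\<close>

lemma cinner_zero_left [simp]: "cinner 0 y = 0"
  using cinner_scaleC_left[of 0 0 y] by simp

lemma cinner_zero_right [simp]: "cinner x 0 = 0"
  using cinner_scaleC_right[of x 0 0] by simp

lemma cinner_minus_left: "cinner (- x) y = - cinner x y"
  using cinner_scaleR_left[of "-1" x y] by simp

lemma cinner_minus_right: "cinner x (- y) = - cinner x y"
  using cinner_scaleR_right[of x "-1" y] by simp

lemma cinner_diff_left: "cinner (x - y) z = cinner x z - cinner y z"
  using cinner_add_left[of "x - y" y z] by simp

lemma cinner_sum_left: "cinner (sum f A) y = (\<Sum>i\<in>A. cinner (f i) y)"
  by (induction A rule: infinite_finite_induct) (auto simp: cinner_add_left)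

lemma cinner_sum_right: "cinner y (sum f A) = (\<Sum>i\<in>A. cinner y (f i))"
  by (induction A rule: infinite_finite_induct) (auto simp: cinner_add_right)

lemma norm_scaleC: "norm (c *\<^sub>C x) = cmod c * norm (x::'a::complex_inner)"
proof -
  have "complex_of_real ((norm (c *\<^sub>C x))\<^sup>2) = c * cnj c * of_real ((norm x)\<^sup>2)"
    by (simp only: cinner_self[symmetric] cinner_scaleC_left cinner_scaleC_right mult_ac)
  also have "\<dots> = of_real ((cmod c * norm x)\<^sup>2)"
    by (simp add: complex_norm_square[symmetric] power_mult_distrib)
  finally have "(norm (c *\<^sub>C x))\<^sup>2 = (cmod c * norm x)\<^sup>2"
    using of_real_eq_iff by blast
  then show ?thesis
    by (simp add: power2_eq_iff_nonneg)
qed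

lemma Re_cinner_self: "Re (cinner x x) = (norm x)\<^sup>2"
  by (simp add: cinner_self)

text \<open>Multiplying one argument by such a \<open>u\<close> makes an inner product real and
  nonnegative, so bounds on real parts become bounds on moduli.\<close>

lemma cinner_unit_phase: "\<exists>u. cmod u = 1 \<and> cnj u * z = of_real (cmod z)"
proof (cases "z = 0")
  case False
  then show ?thesis
    using complex_norm_square[of z]
    by (intro exI[of _ "sgn z"]) (simp add: sgn_eq field_simps norm_divide power2_eq_square)
qed (auto intro: exI[of _ 1])

lemma cmod_cinner_le: "cmod (cinner x y) \<le> norm x * norm y"
proof -
  obtain u where u: "cmod u = 1" "cnj u * cinner x y = of_real (cmod (cinner x y))"
    using cinner_unit_phase by blast
  have "cmod (cinner x y) = Re (cinner x (u *\<^sub>C y))"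
    by (simp add: cinner_scaleC_right u)
  also have "\<dots> \<le> norm x * norm (u *\<^sub>C y)"
    by (rule Re_cinner_le)
  finally show ?thesis
    by (simp add: norm_scaleC u)
qed

lemma bounded_linear_cinner_left: "bounded_linear (\<lambda>x. cinner x y)"
  by (rule bounded_linear_intro[where K = "norm y"])
    (simp_all add: cinner_add_left cinner_scaleR_left cmod_cinner_le scaleR_conv_of_real)

lemma bounded_linear_cinner_right: "bounded_linear (\<lambda>x. cinner y x)"
  by (rule bounded_linear_intro[where K = "norm y"])
    (simp_all add: cinner_add_right cinner_scaleR_right scaleR_conv_of_real cmod_cinner_le mult.commute[of _ "norm y"])

lemma cinner_ext: "(\<And>z. cinner x z = cinner y z) \<Longrightarrow> x = y"
  by (metis cinner_diff_left cinner_self eq_iff_diff_eq_0 norm_eq_zero of_real_eq_0_iff power_eq_0_iff)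

lemma bounded_linear_scaleC: "bounded_linear (\<lambda>x::'a::complex_inner. c *\<^sub>C x)"
  by (rule bounded_linear_intro[where K = "cmod c"])
    (simp_all add: scaleC_add_right norm_scaleC scaleC_scaleC mult.commute flip: scaleC_of_real)

lemma bounded_clinear_bounded_linear: "bounded_clinear T \<Longrightarrow> bounded_linear T"
  by (simp add: bounded_clinear_def)

lemma bounded_clinear_scaleC: "bounded_clinear T \<Longrightarrow> T (c *\<^sub>C x) = c *\<^sub>C T x"
  by (simp add: bounded_clinear_def)

lemma bounded_clinear_add: "bounded_clinear T \<Longrightarrow> T (x + y) = T x + T y"
  by (simp add: bounded_clinear_def linear_add bounded_linear.linear)

lemma bounded_clinear_diff: "bounded_clinear T \<Longrightarrow> T (x - y) = T x - T y"
  by (simp add: bounded_clinear_def linear_diff bounded_linear.linear)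

lemma bounded_clinear_id: "bounded_clinear (\<lambda>x. x)"
  by (simp add: bounded_clinear_def)

lemma bounded_clinear_compose:
  "bounded_clinear S \<Longrightarrow> bounded_clinear T \<Longrightarrow> bounded_clinear (\<lambda>x. S (T x))"
  by (auto simp: bounded_clinear_def intro: bounded_linear_compose)

lemma bounded_clinear_minus:
  "bounded_clinear S \<Longrightarrow> bounded_clinear T \<Longrightarrow> bounded_clinear (\<lambda>x. S x - T x)"
  by (auto simp: bounded_clinear_def complex_vector.scale_right_diff_distrib intro: bounded_linear_sub)

lemma bounded_clinear_scale:
  "bounded_clinear T \<Longrightarrow> bounded_clinear (\<lambda>x. c *\<^sub>C T x)"
  using bounded_linear_compose[OF bounded_linear_scaleC]
  by (auto simp: bounded_clinear_def scaleC_scaleC mult.commute)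

lemma bounded_clinear_funpow:
  fixes T :: "'a::complex_inner \<Rightarrow> 'a"
  shows "bounded_clinear T \<Longrightarrow> bounded_clinear (T ^^ n)"
proof (induction n)
  case 0
  show ?case using bounded_clinear_id by (simp flip: id_def)
next
  case (Suc n)
  then show ?case using bounded_clinear_compose[of T "T ^^ n"] by (simp add: comp_def)
qed

lemma cinner_cadjoint_left:
  fixes T :: "'a::chilbert_space \<Rightarrow> 'b::complex_inner"
  assumes "bounded_clinear T"
  shows "cinner (cadjoint T y) x = cinner y (T x)"
  by (metis assms cinner_cadjoint cinner_commute)

lemma bounded_clinear_cadjoint:
  fixes T :: "'a::chilbert_space \<Rightarrow> 'b::complex_inner"
  assumes T: "bounded_clinear T"
  shows "bounded_clinear (cadjoint T)"
proof -
  have add: "cadjoint T (x + y) = cadjoint T x + cadjoint T y" for x y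
    by (rule cinner_ext) (simp add: cinner_add_left cinner_cadjoint_left[OF T])
  have scale: "cadjoint T (c *\<^sub>C x) = c *\<^sub>C cadjoint T x" for c x
    by (rule cinner_ext) (simp add: cinner_scaleC_left cinner_cadjoint_left[OF T])
  obtain K where K: "\<And>x. norm (T x) \<le> norm x * K" "0 \<le> K"
    using T bounded_linear.nonneg_bounded bounded_clinear_bounded_linear by blast
  \<comment> \<open>Pairing \<open>y\<close> with \<open>T (cadjoint T y)\<close> gives the squared
    norm of \<open>cadjoint T y\<close>; one factor then cancels.\<close>
  have bound: "norm (cadjoint T y) \<le> norm y * K" for y
  proof -
    let ?z = "cadjoint T y"
    have "norm ?z * norm ?z = Re (cinner y (T ?z))"
      by (simp add: Re_cinner_self power2_eq_square flip: cinner_cadjoint_left[OF T])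
    also have "\<dots> \<le> norm y * norm (T ?z)"
      by (rule Re_cinner_le)
    also have "\<dots> \<le> norm y * (norm ?z * K)"
      by (intro mult_left_mono K) simp
    finally have "norm ?z * norm ?z \<le> norm ?z * (norm y * K)"
      by (simp add: mult_ac)
    moreover have "0 \<le> norm y * K"
      using K(2) by simp
    ultimately show ?thesis
      by (cases "?z = 0") (auto simp: mult_le_cancel_left)
  qed
  have "cadjoint T (r *\<^sub>R x) = r *\<^sub>R cadjoint T x" for r x
    using scale[of "of_real r"] by (simp add: scaleC_of_real)
  with add bound show ?thesis
    unfolding bounded_clinear_def using scale by (auto intro!: bounded_linear_intro)
qed

text \<open>An additive Cauchy-Schwarz inequality, from expanding the form at \<open>x\<close> minus
  a phase multiple of \<open>y\<close>. For \<open>D\<close> it bounds off-diagonal entries by the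
  summable diagonal.\<close>

lemma cmod_cinner_positive_le:
  assumes A: "bounded_clinear A"
    and self: "\<And>x y. cinner (A x) y = cinner x (A y)"
    and pos: "\<And>x. 0 \<le> Re (cinner (A x) x)"
  shows "2 * cmod (cinner (A x) y) \<le> Re (cinner (A x) x) + Re (cinner (A y) y)"
proof -
  obtain u where u: "cmod u = 1" "cnj u * cinner (A x) y = of_real (cmod (cinner (A x) y))"
    using cinner_unit_phase by blast
  let ?z = "u *\<^sub>C y"
  have xz: "cinner (A x) ?z = of_real (cmod (cinner (A x) y))"
    by (simp add: cinner_scaleC_right u)
  then have zx: "cinner (A ?z) x = of_real (cmod (cinner (A x) y))"
    by (metis cinner_commute complex_cnj_complex_of_real self)
  have "cinner (A ?z) ?z = u * cnj u * cinner (A y) y"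
    by (simp add: bounded_clinear_scaleC[OF A] cinner_scaleC_left cinner_scaleC_right)
  also have "u * cnj u = 1"
    using u(1) by (simp add: complex_norm_square[symmetric])
  finally have zz: "cinner (A ?z) ?z = cinner (A y) y" by simp
  have "0 \<le> Re (cinner (A (x - ?z)) (x - ?z))" by (rule pos)
  also have "\<dots> = Re (cinner (A x) x) + Re (cinner (A y) y) - 2 * cmod (cinner (A x) y)"
    by (simp add: bounded_clinear_diff[OF A] cinner_diff_left cinner_diff_right xz zx zz)
  finally show ?thesis by simp
qed

section \<open>Orthonormal bases\<close>

text \<open>The vectors orthogonal to \<open>x\<close> form a closed subspace containing the basis,
  hence everything, \<open>x\<close> included.\<close>

lemma orthonormal_basis_total:
  assumes "orthonormal_basis e" and "\<And>k. cinner x (e k) = 0"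
  shows "x = 0"
proof -
  have sub: "complex_vector.subspace {y. cinner x y = 0}"
    by (auto simp: complex_vector.subspace_def cinner_add_right cinner_scaleC_right)
  have "closed {y. cinner x y = 0}"
    using continuous_closed_vimage[of "{0}" "\<lambda>y. cinner x y"]
      linear_continuous_at[OF bounded_linear_cinner_right[of x]]
    by (simp add: vimage_def)
  moreover have "cspan (range e) \<subseteq> {y. cinner x y = 0}"
    by (rule complex_vector.span_minimal[OF _ sub]) (use assms(2) in auto)
  ultimately have "closure (cspan (range e)) \<subseteq> {y. cinner x y = 0}"
    by (rule closure_minimal[rotated])
  then have "cinner x x = 0"
    using assms(1) unfolding orthonormal_basis_def by auto
  then show ?thesis by (simp add: cinner_self)
qed

context
  fixes e :: "nat \<Rightarrow> 'a::chilbert_space"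
  assumes e: "orthonormal_basis e"
begin

lemma cinner_basis: "cinner (e m) (e n) = (if m = n then 1 else 0)"
  using e by (simp add: orthonormal_basis_def)

lemma norm_sum_basis: "finite A \<Longrightarrow> (norm (\<Sum>k\<in>A. c k *\<^sub>C e k))\<^sup>2 = (\<Sum>k\<in>A. (cmod (c k))\<^sup>2)"
proof -
  assume A: "finite A"
  have "complex_of_real ((norm (\<Sum>k\<in>A. c k *\<^sub>C e k))\<^sup>2) =
      (\<Sum>k\<in>A. \<Sum>j\<in>A. if j = k then c k * cnj (c j) else 0)"
    unfolding cinner_self[symmetric] cinner_sum_left cinner_sum_right
    by (intro sum.cong refl) (simp add: cinner_scaleC_left cinner_scaleC_right cinner_basis)
  also have "\<dots> = (\<Sum>k\<in>A. of_real ((cmod (c k))\<^sup>2))"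
    using A by (intro sum.cong) (simp_all add: complex_norm_square del: of_real_power)
  finally show ?thesis
    by (metis of_real_eq_iff of_real_sum)
qed

lemma summable_basis:
  assumes "summable (\<lambda>k. (cmod (c k))\<^sup>2)"
  shows "summable (\<lambda>k. c k *\<^sub>C e k)"
  unfolding summable_Cauchy
proof (intro allI impI)
  fix r :: real assume r: "0 < r"
  then have "0 < r\<^sup>2" by simp
  then obtain N where N: "\<And>m n. m \<ge> N \<Longrightarrow> norm (\<Sum>k=m..<n. (cmod (c k))\<^sup>2) < r\<^sup>2"
    using assms unfolding summable_Cauchy by blast
  have "norm (\<Sum>k=m..<n. c k *\<^sub>C e k) < r" if "m \<ge> N" for m n
  proof -
    have "(norm (\<Sum>k=m..<n. c k *\<^sub>C e k))\<^sup>2 < r\<^sup>2"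
      using N[OF that, of n] by (simp add: norm_sum_basis sum_nonneg)
    then show ?thesis using r by (simp add: power_less_imp_less_base)
  qed
  then show "\<exists>N. \<forall>m\<ge>N. \<forall>n. norm (\<Sum>k=m..<n. c k *\<^sub>C e k) < r" by blast
qed

lemma cinner_suminf_basis:
  assumes "summable (\<lambda>k. (cmod (c k))\<^sup>2)"
  shows "cinner (\<Sum>k. c k *\<^sub>C e k) (e j) = c j"
proof -
  have "(\<lambda>k. cinner (c k *\<^sub>C e k) (e j)) sums cinner (\<Sum>k. c k *\<^sub>C e k) (e j)"
    by (intro bounded_linear.sums[OF bounded_linear_cinner_left] summable_sums summable_basis assms)
  moreover have "(\<lambda>k. cinner (c k *\<^sub>C e k) (e j)) = (\<lambda>k. if k = j then c k else 0)"
    by (auto simp: cinner_scaleC_left cinner_basis)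
  ultimately show ?thesis
    using sums_single[of j c] sums_unique2 by metis
qed

text \<open>The partial sum is orthogonal to the remainder, so Pythagoras applies.\<close>

lemma bessel: "(\<Sum>k<n. (cmod (cinner x (e k)))\<^sup>2) \<le> (norm x)\<^sup>2"
proof -
  let ?y = "\<Sum>k<n. cinner x (e k) *\<^sub>C e k"
  have "cinner ?y (x - ?y) = (\<Sum>k<n. cinner x (e k) * cinner (e k) (x - ?y))"
    by (simp add: cinner_sum_left cinner_scaleC_left)
  also have "\<dots> = (\<Sum>k<n. cinner x (e k) * cnj (cinner (x - ?y) (e k)))"
    by (metis cinner_commute)
  also have "\<dots> = 0"
    by (intro sum.neutral)
      (auto simp: cinner_diff_left cinner_sum_left cinner_scaleC_left cinner_basis if_distrib cong: if_cong)
  finally have "(norm x)\<^sup>2 = (norm ?y)\<^sup>2 + (norm (x - ?y))\<^sup>2"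
    using norm_add_sq[of ?y "x - ?y"] by simp
  then show ?thesis by (simp add: norm_sum_basis)
qed

lemma summable_cinner_basis: "summable (\<lambda>k. (cmod (cinner x (e k)))\<^sup>2)"
  by (rule summableI_nonneg_bounded[OF _ bessel]) simp

text \<open>The remainder is orthogonal to every basis vector, so totality makes it zero.\<close>

lemma sums_basis: "(\<lambda>k. cinner x (e k) *\<^sub>C e k) sums x"
proof -
  have "x - (\<Sum>k. cinner x (e k) *\<^sub>C e k) = 0"
    by (rule orthonormal_basis_total[OF e])
      (simp add: cinner_diff_left cinner_suminf_basis summable_cinner_basis)
  then show ?thesis
    using summable_sums[OF summable_basis[OF summable_cinner_basis[of x]]] by simp
qed

lemma sums_cinner: "(\<lambda>k. cinner x (e k) * cnj (cinner y (e k))) sums cinner x y"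
proof -
  have "(\<lambda>k. cinner (cinner x (e k) *\<^sub>C e k) y) sums cinner x y"
    by (intro bounded_linear.sums[OF bounded_linear_cinner_left] sums_basis)
  moreover have "cinner (cinner x (e k) *\<^sub>C e k) y = cinner x (e k) * cnj (cinner y (e k))" for k
    by (metis cinner_commute cinner_scaleC_left)
  ultimately show ?thesis by simp
qed

lemma parseval: "(\<lambda>k. (cmod (cinner x (e k)))\<^sup>2) sums (norm x)\<^sup>2"
  using sums_Re[OF sums_cinner[of x x]]
  by (simp add: Re_cinner_self flip: complex_norm_square)

lemma cinner_finite:
  assumes "finite A" "\<And>k. k \<notin> A \<Longrightarrow> cinner x (e k) = 0 \<or> cinner y (e k) = 0"
  shows "cinner x y = (\<Sum>k\<in>A. cinner x (e k) * cnj (cinner y (e k)))"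
  by (rule sums_unique2[OF sums_cinner sums_finite]) (use assms in auto)

end

section \<open>Square roots of positive operators\<close>

text \<open>Taylor coefficients of sqrt (1 - t) at 0.\<close>

definition sqrt_coeff :: "nat \<Rightarrow> real" where
  "sqrt_coeff k = (- 1) ^ k * ((1 / 2) gchoose k)"

lemma sqrt_coeff_0 [simp]: "sqrt_coeff 0 = 1"
  by (simp add: sqrt_coeff_def)

lemma sqrt_coeff_Suc: "sqrt_coeff (Suc k) = sqrt_coeff k * (real k - 1 / 2) / (real k + 1)"
proof -
  have "(1 / 2 :: real) gchoose Suc k = (1 / 2 - real k) * ((1 / 2) gchoose k) / (real k + 1)"
    using gbinomial_mult_1[of "1 / 2 :: real" k] by (simp add: field_simps)
  then show ?thesis
    unfolding sqrt_coeff_def by (simp only:) (simp add: field_simps)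
qed

text \<open>Starting from the coefficient -1/2 at index 1, successive ratios are positive, so the
  sign never changes.\<close>

lemma sqrt_coeff_Suc_nonpos: "sqrt_coeff (Suc k) \<le> 0"
proof (induction k)
  case (Suc k)
  have "sqrt_coeff (Suc (Suc k)) = sqrt_coeff (Suc k) * ((real (Suc k) - 1 / 2) / (real (Suc k) + 1))"
    by (subst sqrt_coeff_Suc) simp
  then show ?case
    using Suc by (simp only:) (rule mult_nonpos_nonneg, auto)
qed (simp add: sqrt_coeff_Suc)

lemma sqrt_coeff_sums:
  assumes "\<bar>t\<bar> < 1"
  shows "(\<lambda>k. sqrt_coeff k * t ^ k) sums sqrt (1 - t)"
  using gen_binomial_real[of "- t" "1 / 2"] assms
  by (simp add: sqrt_coeff_def powr_half_sqrt power_minus[of t] mult_ac)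

text \<open>For 0 < t < 1 the weighted partial sum is sqrt (1 - t) minus a tail of nonpositive
  terms; then t tends to 1 from the left.\<close>

lemma sum_sqrt_coeff_nonneg: "0 \<le> (\<Sum>k<n. sqrt_coeff k)"
proof -
  have "0 \<le> (\<Sum>k<n. sqrt_coeff k * t ^ k)" if t: "0 < t" "t < 1" for t
  proof (cases n)
    case (Suc m)
    have sums: "(\<lambda>k. sqrt_coeff k * t ^ k) sums sqrt (1 - t)"
      using sqrt_coeff_sums t by simp
    have "(\<Sum>k. sqrt_coeff (k + n) * t ^ (k + n)) \<le> 0"
      by (intro suminf_le_const summable_ignore_initial_segment sums_summable[OF sums] sum_nonpos
          mult_nonpos_nonneg) (use t Suc sqrt_coeff_Suc_nonpos in auto)
    moreover have "sqrt (1 - t) = (\<Sum>k. sqrt_coeff (k + n) * t ^ (k + n)) + (\<Sum>k<n. sqrt_coeff k * t ^ k)"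
      using suminf_split_initial_segment[OF sums_summable[OF sums], of n] sums_unique[OF sums] by simp
    moreover have "0 \<le> sqrt (1 - t)" using t by simp
    ultimately show ?thesis by linarith
  qed simp
  then have ev: "\<forall>\<^sub>F t in at_left 1. 0 \<le> (\<Sum>k<n. sqrt_coeff k * t ^ k)"
    by (intro eventually_at_leftI[of 0]) auto
  have "((\<lambda>t. \<Sum>k<n. sqrt_coeff k * t ^ k) \<longlongrightarrow> (\<Sum>k<n. sqrt_coeff k * 1 ^ k)) (at_left 1)"
    by (intro tendsto_intros)
  then show ?thesis
    using tendsto_lowerbound[OF _ ev] by simp
qed

text \<open>Only the first coefficient is positive, so a nonempty partial sum of moduli is 2 minus a
  nonnegative partial sum.\<close>

lemma summable_abs_sqrt_coeff: "summable (\<lambda>k. \<bar>sqrt_coeff k\<bar>)"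
proof (rule summableI_nonneg_bounded)
  fix n
  show "(\<Sum>k<n. \<bar>sqrt_coeff k\<bar>) \<le> 2"
  proof (cases n)
    case (Suc m)
    have "(\<Sum>k<n. \<bar>sqrt_coeff k\<bar>) = 2 - (\<Sum>k<n. sqrt_coeff k)"
      using sqrt_coeff_Suc_nonpos
      by (simp add: Suc sum.lessThan_Suc_shift abs_of_nonpos sum_negf del: sum.lessThan_Suc)
    then show ?thesis using sum_sqrt_coeff_nonneg[of n] by simp
  qed simp
qed simp

text \<open>Vandermonde at 1/2 + 1/2 = 1: squaring the series gives back the coefficients of 1 -
  t.\<close>

lemma sqrt_coeff_convolution:
  "(\<Sum>k\<le>n. sqrt_coeff k * sqrt_coeff (n - k)) = (if n = 0 then 1 else if n = 1 then - 1 else 0)"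
proof -
  have "(\<Sum>k\<le>n. sqrt_coeff k * sqrt_coeff (n - k)) =
      (\<Sum>k\<le>n. (- 1) ^ n * (((1 / 2) gchoose k) * ((1 / 2) gchoose (n - k))))"
    by (intro sum.cong) (auto simp: sqrt_coeff_def simp flip: power_add)
  also have "\<dots> = (- 1) ^ n * ((1 / 2 + 1 / 2 :: real) gchoose n)"
    by (simp only: gbinomial_Vandermonde[symmetric] atLeast0AtMost sum_distrib_left)
  also have "(1 / 2 + 1 / 2 :: real) gchoose n = of_nat (1 choose n)"
    using binomial_gbinomial[of 1 n, where 'a = real] by simp
  finally show ?thesis
    by (cases n) (auto simp: binomial_eq_0)
qed

text \<open>For a contraction \<open>B\<close> the binomial series of \<open>sqrt (1 - t)\<close> converges absolutely at \<open>B\<close>.\<close>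

definition sqrt_one_minus :: "('a::complex_inner \<Rightarrow> 'a) \<Rightarrow> 'a \<Rightarrow> 'a" where
  "sqrt_one_minus B x = (\<Sum>k. sqrt_coeff k *\<^sub>R (B ^^ k) x)"

context
  fixes B :: "'a::chilbert_space \<Rightarrow> 'a"
  assumes B: "bounded_clinear B" and contraction: "\<And>x. norm (B x) \<le> norm x"
begin

lemma norm_funpow_contraction: "norm ((B ^^ k) x) \<le> norm x"
  by (induction k) (auto intro: order_trans[OF contraction])

lemma summable_norm_sqrt_series: "summable (\<lambda>k. norm (sqrt_coeff k *\<^sub>R (B ^^ k) x))"
  by (rule summable_comparison_test'[OF summable_mult2[OF summable_abs_sqrt_coeff, of "norm x"], of 0])
    (simp add: mult_left_mono norm_funpow_contraction)

lemma summable_sqrt_series: "summable (\<lambda>k. sqrt_coeff k *\<^sub>R (B ^^ k) x)"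
  by (rule summable_norm_cancel[OF summable_norm_sqrt_series])

lemma infsum_sqrt_series: "(\<Sum>\<^sub>\<infinity>k. sqrt_coeff k *\<^sub>R (B ^^ k) x) = sqrt_one_minus B x"
  unfolding sqrt_one_minus_def
  by (intro infsumI norm_summable_imp_has_sum summable_norm_sqrt_series summable_sums summable_sqrt_series)

text \<open>\<open>N\<close> need only be real-linear, so real scalings are covered too.\<close>

lemma sqrt_one_minus_commute:
  assumes N: "bounded_linear N" and NB: "\<And>x. N (B x) = B (N x)"
  shows "N (sqrt_one_minus B x) = sqrt_one_minus B (N x)"
proof -
  have "N ((B ^^ k) x) = (B ^^ k) (N x)" for k
    by (induction k) (simp_all add: NB)
  then show ?thesis
    unfolding sqrt_one_minus_def bounded_linear.suminf[OF N summable_sqrt_series]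
    by (simp add: linear_scale[OF bounded_linear.linear[OF N]])
qed

lemma sqrt_one_minus_diff: "sqrt_one_minus B (x - y) = sqrt_one_minus B x - sqrt_one_minus B y"
  unfolding sqrt_one_minus_def
  by (simp add: bounded_clinear_diff[OF bounded_clinear_funpow[OF B]] scaleR_diff_right
      suminf_diff summable_sqrt_series)

text \<open>Each term is at least its coefficient times the squared norm, as \<open>B\<close> is a
  contraction and the later coefficients are nonpositive. Nonnegativity of the coefficient sums then
  passes to the limit.\<close>

lemma sqrt_one_minus_positive: "0 \<le> Re (cinner (sqrt_one_minus B x) x)"
proof -
  let ?f = "\<lambda>k. sqrt_coeff k *\<^sub>R (B ^^ k) x"
  have "?f sums sqrt_one_minus B x"
    unfolding sqrt_one_minus_def by (intro summable_sums summable_sqrt_series)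
  then have "(\<lambda>k. Re (cinner (?f k) x)) sums Re (cinner (sqrt_one_minus B x) x)"
    by (intro sums_Re bounded_linear.sums[OF bounded_linear_cinner_left])
  then have lim: "(\<lambda>n. \<Sum>k<n. Re (cinner (?f k) x)) \<longlonglongrightarrow> Re (cinner (sqrt_one_minus B x) x)"
    by (simp add: sums_def)
  have le: "sqrt_coeff k * (norm x)\<^sup>2 \<le> Re (cinner (?f k) x)" for k
  proof (cases k)
    case 0
    then show ?thesis by (simp add: Re_cinner_self)
  next
    case (Suc m)
    have "Re (cinner ((B ^^ k) x) x) \<le> norm ((B ^^ k) x) * norm x"
      by (rule Re_cinner_le)
    also have "\<dots> \<le> (norm x)\<^sup>2"
      by (simp add: power2_eq_square mult_right_mono norm_funpow_contraction)
    finally have "sqrt_coeff k * (norm x)\<^sup>2 \<le> sqrt_coeff k * Re (cinner ((B ^^ k) x) x)"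
      using Suc sqrt_coeff_Suc_nonpos by (simp add: mult_left_mono_neg)
    then show ?thesis by (simp add: cinner_scaleR_left)
  qed
  have "0 \<le> (\<Sum>k<n. Re (cinner (?f k) x))" for n
  proof -
    have "0 \<le> (\<Sum>k<n. sqrt_coeff k) * (norm x)\<^sup>2"
      by (intro mult_nonneg_nonneg sum_sqrt_coeff_nonneg) simp
    also have "\<dots> \<le> (\<Sum>k<n. Re (cinner (?f k) x))"
      unfolding sum_distrib_right by (intro sum_mono le)
    finally show ?thesis .
  qed
  then show ?thesis
    by (intro LIMSEQ_le_const[OF lim]) auto
qed

text \<open>Cauchy product: the absolutely convergent double series is regrouped along i + j = n,
  where the convolution identity leaves only n = 0 and n = 1.\<close>

lemma sqrt_one_minus_square: "sqrt_one_minus B (sqrt_one_minus B x) = x - B x"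
proof -
  define F where "F = (\<lambda>(i, j). (sqrt_coeff i * sqrt_coeff j) *\<^sub>R (B ^^ (i + j)) x)"
  have coeff: "(\<lambda>k. \<bar>sqrt_coeff k\<bar>) summable_on UNIV"
    using norm_summable_imp_summable_on[of "\<lambda>k. \<bar>sqrt_coeff k\<bar>"] summable_abs_sqrt_coeff by simp
  have "(\<lambda>p. norm (sqrt_coeff (fst p) * (sqrt_coeff (snd p) * norm x))) summable_on UNIV \<times> UNIV"
    unfolding Infinite_Sum.abs_summable_on_Sigma_iff
    by (simp add: abs_mult infsum_cmult_right' infsum_cmult_left' summable_on_cmult_right
        summable_on_cmult_left coeff)
  then have "(\<lambda>p. norm (F p)) summable_on UNIV \<times> UNIV"
    by (rule Infinite_Sum.abs_summable_on_comparison_test)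
      (auto simp: F_def abs_mult mult.assoc intro!: mult_left_mono norm_funpow_contraction)
  then have F: "F summable_on UNIV \<times> UNIV"
    by (rule abs_summable_summable)
  have inner: "(\<Sum>\<^sub>\<infinity>j. F (i, j)) = sqrt_coeff i *\<^sub>R (B ^^ i) (sqrt_one_minus B x)" for i
  proof -
    have lin: "bounded_linear (\<lambda>y. sqrt_coeff i *\<^sub>R (B ^^ i) y)"
      by (intro bounded_linear_const_scaleR bounded_clinear_bounded_linear bounded_clinear_funpow B)
    have "((\<lambda>j. sqrt_coeff i *\<^sub>R (B ^^ i) (sqrt_coeff j *\<^sub>R (B ^^ j) x)) has_sum
        sqrt_coeff i *\<^sub>R (B ^^ i) (sqrt_one_minus B x)) UNIV"
      unfolding sqrt_one_minus_def
      by (intro has_sum_bounded_linear[OF lin] norm_summable_imp_has_sum summable_norm_sqrt_series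
          summable_sums summable_sqrt_series)
    moreover have "sqrt_coeff i *\<^sub>R (B ^^ i) (sqrt_coeff j *\<^sub>R (B ^^ j) x) = F (i, j)" for j
      by (simp add: F_def funpow_add
          linear_scale[OF bounded_linear.linear[OF bounded_clinear_bounded_linear[OF bounded_clinear_funpow[OF B]]]])
    ultimately show ?thesis by (simp add: infsumI)
  qed
  have bij: "bij_betw (\<lambda>(n, i). (i, n - i)) (SIGMA n:UNIV. {..n}) (UNIV \<times> UNIV :: (nat \<times> nat) set)"
    by (rule bij_betw_byWitness[where f' = "\<lambda>(i, j). (i + j, i)"]) auto
  have "sqrt_one_minus B (sqrt_one_minus B x) = (\<Sum>\<^sub>\<infinity>i. \<Sum>\<^sub>\<infinity>j. F (i, j))"
    by (simp add: inner infsum_sqrt_series)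
  also have "\<dots> = infsum F (UNIV \<times> UNIV)"
    by (rule infsum_Sigma_banach[OF F])
  also have "\<dots> = infsum (\<lambda>p. F (case p of (n, i) \<Rightarrow> (i, n - i))) (SIGMA n:UNIV. {..n})"
    by (rule infsum_reindex_bij_betw[OF bij, symmetric])
  also have "\<dots> = (\<Sum>\<^sub>\<infinity>n. \<Sum>\<^sub>\<infinity>i\<in>{..n}. F (i, n - i))"
    using infsum_Sigma_banach[OF iffD2[OF summable_on_reindex_bij_betw[OF bij] F]] by simp
  also have "\<dots> = (\<Sum>\<^sub>\<infinity>n. (if n = (0::nat) then x else if n = 1 then - B x else 0))"
  proof (rule infsum_cong)
    fix n
    have "(\<Sum>\<^sub>\<infinity>i\<in>{..n}. F (i, n - i)) = (\<Sum>i\<le>n. sqrt_coeff i * sqrt_coeff (n - i)) *\<^sub>R (B ^^ n) x"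
      by (simp add: F_def scaleR_sum_left)
    then show "(\<Sum>\<^sub>\<infinity>i\<in>{..n}. F (i, n - i)) = (if n = 0 then x else if n = 1 then - B x else 0)"
      by (simp add: sqrt_coeff_convolution)
  qed
  also have "\<dots> = (\<Sum>\<^sub>\<infinity>n\<in>{0, 1}. (if n = (0::nat) then x else if n = 1 then - B x else 0))"
    by (rule infsum_cong_neutral) auto
  finally show ?thesis by simp
qed

end

section \<open>Hyperinvariant subspaces\<close>

text \<open>The adjoint of an operator commuting with \<open>T\<close> preserves the kernel
  \<open>Z\<close> of the adjoint of \<open>T - d\<close>, so the operator preserves the orthogonal
  complement of \<open>Z\<close>. This complement contains the range of \<open>T - d\<close> but not
  \<open>x\<close>.\<close>

lemma hyperinvariant_of_adjoint_eigenvector: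
  fixes T :: "'a::chilbert_space \<Rightarrow> 'a"
  assumes T: "bounded_clinear T" and nonscalar: "\<not> (\<exists>c. \<forall>x. T x = c *\<^sub>C x)"
    and x: "x \<noteq> 0" "\<And>y. cinner (T y - d *\<^sub>C y) x = 0"
  shows "\<exists>M. csubspace M \<and> closed M \<and> hyperinvariant T M \<and> M \<noteq> {0} \<and> M \<noteq> UNIV"
proof -
  define Z where "Z = {z. \<forall>y. cinner (T y - d *\<^sub>C y) z = 0}"
  define M where "M = {m. \<forall>z. z \<in> Z \<longrightarrow> cinner m z = 0}"
  have "csubspace M"
    by (auto simp: complex_vector.subspace_def M_def cinner_add_left cinner_scaleC_left)
  moreover have "closed M"
    unfolding M_def
    by (intro closed_Collect_all closed_Collect_imp open_Collect_const closed_Collect_eq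
        linear_continuous_on bounded_linear_cinner_left continuous_on_const)
  moreover have "hyperinvariant T M"
    unfolding hyperinvariant_def
  proof (intro allI impI subsetI)
    fix S y assume S: "bounded_clinear S \<and> S \<circ> T = T \<circ> S" and "y \<in> S ` M"
    then obtain m where m: "m \<in> M" "y = S m" by blast
    have "S (T v - d *\<^sub>C v) = T (S v) - d *\<^sub>C S v" for v
      using S by (simp add: bounded_clinear_diff bounded_clinear_scaleC fun_eq_iff)
    then have "cadjoint S z \<in> Z" if "z \<in> Z" for z
      using S that by (simp add: Z_def flip: cinner_cadjoint)
    then show "y \<in> M"
      using S m by (simp add: M_def cinner_cadjoint)
  qed
  moreover have "M \<noteq> {0}"
  proof
    assume "M = {0}"
    moreover have "T y - d *\<^sub>C y \<in> M" for y by (simp add: M_def Z_def)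
    ultimately have "\<forall>y. T y = d *\<^sub>C y" by simp
    then show False using nonscalar by blast
  qed
  moreover have "x \<notin> M"
  proof -
    have "x \<in> Z" using x(2) by (simp add: Z_def)
    moreover have "cinner x x \<noteq> 0" using x(1) by (simp add: cinner_self)
    ultimately show ?thesis unfolding M_def by blast
  qed
  ultimately show ?thesis by blast
qed

text \<open>The ratios of a log-convex sequence increase, so a geometric upper bound is a bound for
  each of them.\<close>

lemma log_convex_geometric_bound:
  fixes a :: "nat \<Rightarrow> real"
  assumes nonneg: "\<And>n. 0 \<le> a n" and convex: "\<And>n. (a (Suc n))\<^sup>2 \<le> a (Suc (Suc n)) * a n"
    and bound: "\<And>n. a n \<le> C * c ^ n" and c: "0 < c"
  shows "a n \<le> c ^ n * a 0"
proof -
  \<comment> \<open>Only the first ratio needs an argument: shifted sequences satisfy the same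
    hypotheses with another constant.\<close>
  have step: "b (Suc 0) \<le> c * b 0"
    if b: "\<And>n. 0 \<le> b n" "\<And>n. (b (Suc n))\<^sup>2 \<le> b (Suc (Suc n)) * b n" "\<And>n. b n \<le> D * c ^ n"
    for b :: "nat \<Rightarrow> real" and D
  proof (rule ccontr)
    assume neg: "\<not> b (Suc 0) \<le> c * b 0"
    have b0: "0 < b 0"
    proof (rule ccontr)
      assume "\<not> 0 < b 0"
      then have "b 0 = 0" using b(1)[of 0] by simp
      then show False using b(2)[of 0] neg by simp
    qed
    \<comment> \<open>Log-convexity keeps all later ratios at least \<open>r\<close>; growth like
      powers of \<open>r\<close> > \<open>c\<close> contradicts the bound.\<close>
    define r where "r = b (Suc 0) / b 0"
    have r: "c < r" using neg b0 by (simp add: r_def field_simps)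
    then have "0 < r" using c by simp
    have grow: "0 < b n \<and> r * b n \<le> b (Suc n)" for n
    proof (induction n)
      case 0
      then show ?case using b0 by (simp add: r_def)
    next
      case (Suc n)
      then have pos: "0 < b (Suc n)" using \<open>0 < r\<close> by (meson less_le_trans mult_pos_pos)
      have "r * b (Suc n) * b n \<le> b (Suc n) * b (Suc n)"
        using Suc pos by (simp add: mult_ac mult_left_mono)
      also have "\<dots> \<le> b (Suc (Suc n)) * b n" using b(2)[of n] by (simp add: power2_eq_square)
      finally show ?case using Suc pos by (simp add: mult_le_cancel_right)
    qed
    have "r ^ n * b 0 \<le> b n" for n
    proof (induction n)
      case (Suc n)
      have "r ^ Suc n * b 0 \<le> r * b n" using Suc \<open>0 < r\<close> by (simp add: mult.assoc mult_left_mono)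
      then show ?case using grow[of n] by linarith
    qed simp
    then have le: "(r / c) ^ n * b 0 \<le> D" for n
      using b(3)[of n] c by (simp add: power_divide field_simps) (metis order_trans)
    have "1 < r / c" using r c by simp
    then obtain n where "D / b 0 < (r / c) ^ n" using real_arch_pow by blast
    then show False using le[of n] b0 by (simp add: field_simps)
  qed
  have le: "a (Suc n) \<le> c * a n" for n
  proof -
    have "a (Suc 0 + n) \<le> c * a (0 + n)"
    proof (rule step[of "\<lambda>k. a (k + n)" "C * c ^ n"])
      show "a (k + n) \<le> C * c ^ n * c ^ k" for k
        using bound[of "k + n"] by (simp add: power_add mult_ac)
    qed (use nonneg convex in simp_all)
    then show ?thesis by simp
  qed
  show ?thesis
  proof (induction n)
    case (Suc n)
    have "a (Suc n) \<le> c * a n" by (rule le)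
    also have "\<dots> \<le> c * (c ^ n * a 0)" using Suc c by (simp add: mult_left_mono)
    finally show ?case by (simp add: mult.assoc)
  qed simp
qed

text \<open>Log-convexity of \<open>n \<mapsto> norm (N\<^sup>n x)\<close> lets the constant \<open>norm x\<close> be replaced by an arbitrary
  one; the former description shows closedness and the latter linearity and hyperinvariance.\<close>

lemma growth_subspace:
  fixes N :: "'a::complex_inner \<Rightarrow> 'a"
  assumes N: "bounded_clinear N" and paranormal: "\<And>x. (norm (N x))\<^sup>2 \<le> norm (N (N x)) * norm x"
    and c: "0 < c"
  defines "M \<equiv> {x. \<forall>n. norm ((N ^^ n) x) \<le> c ^ n * norm x}"
  shows "csubspace M" "closed M" "hyperinvariant N M"
proof -
  have M: "x \<in> M \<longleftrightarrow> (\<exists>C. \<forall>n. norm ((N ^^ n) x) \<le> C * c ^ n)" for x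
  proof
    assume "x \<in> M"
    then show "\<exists>C. \<forall>n. norm ((N ^^ n) x) \<le> C * c ^ n"
      by (auto simp: M_def mult.commute intro!: exI[of _ "norm x"])
  next
    assume "\<exists>C. \<forall>n. norm ((N ^^ n) x) \<le> C * c ^ n"
    then obtain C where "norm ((N ^^ n) x) \<le> C * c ^ n" for n by blast
    then have "norm ((N ^^ n) x) \<le> c ^ n * norm ((N ^^ 0) x)" for n
      by (intro log_convex_geometric_bound[where a = "\<lambda>n. norm ((N ^^ n) x)" and C = C] c)
        (use paranormal in simp_all)
    then show "x \<in> M" by (simp add: M_def)
  qed
  note Nn = bounded_clinear_funpow[OF N]
  show "csubspace M"
    unfolding complex_vector.subspace_def
  proof (intro conjI ballI allI)
    have "(N ^^ n) 0 = 0" for n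
      using bounded_clinear_diff[OF Nn, of n 0 0] by simp
    then show "0 \<in> M" by (simp add: M_def)
  next
    fix x y assume "x \<in> M" "y \<in> M"
    then obtain C D where "\<And>n. norm ((N ^^ n) x) \<le> C * c ^ n" "\<And>n. norm ((N ^^ n) y) \<le> D * c ^ n"
      unfolding M by blast
    then have "norm ((N ^^ n) (x + y)) \<le> (C + D) * c ^ n" for n
      by (simp add: bounded_clinear_add[OF Nn] norm_triangle_le add_mono distrib_right)
    then show "x + y \<in> M" unfolding M by blast
  next
    fix d x assume "x \<in> M"
    then show "d *\<^sub>C x \<in> M"
      by (auto simp: M_def bounded_clinear_scaleC[OF Nn] norm_scaleC mult.left_commute intro: mult_left_mono)
  qed
  have "closed {x. norm ((N ^^ n) x) \<le> c ^ n * norm x}" for n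
    by (intro closed_Collect_le continuous_intros continuous_on_norm
        linear_continuous_on bounded_clinear_bounded_linear Nn)
  then show "closed M"
    unfolding M_def by (rule closed_Collect_all)
  show "hyperinvariant N M"
    unfolding hyperinvariant_def
  proof (intro allI impI subsetI)
    fix S y assume S: "bounded_clinear S \<and> S \<circ> N = N \<circ> S" and "y \<in> S ` M"
    then obtain x where y: "y = S x" and "x \<in> M" by blast
    then obtain C where C: "\<And>n. norm ((N ^^ n) x) \<le> C * c ^ n"
      unfolding M by blast
    obtain K where K: "\<And>x. norm (S x) \<le> norm x * K" "0 \<le> K"
      using S bounded_linear.nonneg_bounded bounded_clinear_bounded_linear by blast
    have "S (N z) = N (S z)" for z using S by (simp add: fun_eq_iff)
    then have "(N ^^ n) (S x) = S ((N ^^ n) x)" for n by (induction n) simp_all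
    then have "norm ((N ^^ n) y) \<le> norm ((N ^^ n) x) * K" for n using K y by simp
    also have "norm ((N ^^ n) x) * K \<le> (C * K) * c ^ n" for n
      using mult_right_mono[OF C[of n] K(2)] by (simp add: mult_ac)
    finally show "y \<in> M" unfolding M by blast
  qed
qed

section \<open>Normal operators\<close>

lemma positive_contraction:
  assumes A: "bounded_clinear A"
    and self: "\<And>x y. cinner (A x) y = cinner x (A y)"
    and bounds: "\<And>x. 0 \<le> Re (cinner (A x) x)" "\<And>x. Re (cinner (A x) x) \<le> (norm x)\<^sup>2"
  shows "norm (A x) \<le> norm x"
proof -
  \<comment> \<open>Positivity is applied to the pair \<open>x\<close>, \<open>A x\<close>, whose
    inner product entry is the squared norm of \<open>A x\<close>.\<close>
  have "2 * (norm (A x))\<^sup>2 \<le> Re (cinner (A x) x) + Re (cinner (A (A x)) (A x))"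
    using cmod_cinner_positive_le[OF A self bounds(1), of x "A x"]
    by (simp add: cinner_self norm_power)
  also have "\<dots> \<le> (norm x)\<^sup>2 + (norm (A x))\<^sup>2" by (intro add_mono bounds)
  finally show ?thesis by (simp add: power2_le_iff_abs_le)
qed

text \<open>With \<open>R = N\<^sup>* N - c\<^sup>2\<close> the vector \<open>u = (|R| - R) w\<close> lies in the kernel of \<open>|R| + R\<close>, which is
  invariant under \<open>N\<close> and on which \<open>R\<close> is negative, that is, \<open>norm (N y) \<le> c * norm y\<close>.\<close>

lemma normal_slow_vector:
  fixes N :: "'a::chilbert_space \<Rightarrow> 'a"
  assumes N: "bounded_clinear N" and normal: "\<And>x. cadjoint N (N x) = N (cadjoint N x)"
    and c: "0 < c" and w: "norm (N w) < c * norm w"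
  shows "\<exists>u. u \<noteq> 0 \<and> (\<forall>n. norm ((N ^^ n) u) \<le> c ^ n * norm u)"
proof -
  define R where "R = (\<lambda>x. cadjoint N (N x) - complex_of_real (c\<^sup>2) *\<^sub>C x)"
  note adj = cinner_cadjoint_left[OF N] cinner_cadjoint[OF N, symmetric]
  have R: "bounded_clinear R"
    unfolding R_def by (intro bounded_clinear_minus bounded_clinear_scale bounded_clinear_id
        bounded_clinear_compose[OF bounded_clinear_cadjoint[OF N] N])
  have R_self: "cinner (R x) y = cinner x (R y)" for x y
    by (simp add: R_def cinner_diff_left cinner_diff_right cinner_scaleC_left cinner_scaleC_right
        adj)
  have R_quad: "Re (cinner (R x) x) = (norm (N x))\<^sup>2 - c\<^sup>2 * (norm x)\<^sup>2" for x
    by (simp add: R_def cinner_diff_left cinner_scaleC_left adj cinner_self flip: of_real_power)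
  have NR: "N (R x) = R (N x)" for x
    by (simp add: R_def bounded_clinear_diff[OF N] bounded_clinear_scaleC[OF N] normal)
  obtain K where K: "0 < K" "\<And>x. norm (R x) \<le> norm x * K"
    using bounded_linear.pos_bounded[OF bounded_clinear_bounded_linear[OF R]] by blast
  \<comment> \<open>As \<open>K\<close> bounds \<open>R\<close>, this is a positive contraction, and
    the square root of 1 - \<open>B\<close> is |R| / \<open>K\<close>.\<close>
  define B where "B = (\<lambda>x. x - complex_of_real (1 / K\<^sup>2) *\<^sub>C R (R x))"
  have B: "bounded_clinear B"
    unfolding B_def
    by (rule bounded_clinear_minus[OF bounded_clinear_id bounded_clinear_scale[OF bounded_clinear_compose[OF R R]]])
  have B_self: "cinner (B x) y = cinner x (B y)" for x y
    by (simp add: B_def cinner_diff_left cinner_diff_right cinner_scaleC_left cinner_scaleC_right R_self)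
  have B_quad: "Re (cinner (B x) x) = (norm x)\<^sup>2 - (norm (R x))\<^sup>2 / K\<^sup>2" for x
    by (simp add: B_def cinner_diff_left cinner_scaleC_left R_self[of "R x"] cinner_self
        flip: of_real_power of_real_divide)
  have "norm (B x) \<le> norm x" for x
  proof (rule positive_contraction[OF B B_self])
    fix x
    have "(norm (R x))\<^sup>2 \<le> (norm x * K)\<^sup>2" by (intro power_mono K) simp
    then show "0 \<le> Re (cinner (B x) x)"
      using K(1) by (simp add: B_quad field_simps power_mult_distrib)
    show "Re (cinner (B x) x) \<le> (norm x)\<^sup>2" by (simp add: B_quad)
  qed
  note contraction = this
  note lin = bounded_clinear_bounded_linear
  \<comment> \<open>\<open>S\<close> serves as |R|: it is positive, has the same square as
    \<open>R\<close>, and commutes with the bounded operators commuting with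
    \<open>R\<close>.\<close>
  define S where "S = (\<lambda>x. K *\<^sub>R sqrt_one_minus B x)"
  have S_commute: "P (S x) = S (P x)" if P: "bounded_clinear P" and PR: "\<And>x. P (R x) = R (P x)" for P x
  proof -
    have "P (B y) = B (P y)" for y
      by (simp add: B_def bounded_clinear_diff[OF P] bounded_clinear_scaleC[OF P] PR)
    then show ?thesis
      using sqrt_one_minus_commute[OF B contraction lin[OF P]]
      by (simp add: S_def linear_scale[OF bounded_linear.linear[OF lin[OF P]]])
  qed
  have S_S: "S (S x) = R (R x)" for x
  proof -
    have "sqrt_one_minus B (K *\<^sub>R y) = K *\<^sub>R sqrt_one_minus B y" for y
      using sqrt_one_minus_commute[OF B contraction bounded_linear_scaleR_right[of K]]
      by (simp add: linear_scale[OF bounded_linear.linear[OF lin[OF B]]])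
    then have "S (S x) = K\<^sup>2 *\<^sub>R (x - B x)"
      by (simp add: S_def sqrt_one_minus_square[OF B contraction] power2_eq_square)
    also have "\<dots> = R (R x)"
      using K(1) by (simp add: B_def scaleC_of_real del: of_real_divide of_real_power)
    finally show ?thesis .
  qed
  have S_pos: "0 \<le> Re (cinner (S x) x)" for x
    using K(1) sqrt_one_minus_positive[OF B contraction] by (simp add: S_def cinner_scaleR_left)
  define u where "u = S w - R w"
  have Su: "S u = - R u"
    using S_commute[OF R refl] 
    by (simp add: u_def bounded_clinear_diff[OF R] S_S)
      (simp add: S_def sqrt_one_minus_diff[OF B contraction] scaleR_diff_right S_S[unfolded S_def])
  have kernel: "S ((N ^^ n) u) = - R ((N ^^ n) u)" for n
  proof (induction n)
    case (Suc n)
    have "N (- y) = - N y" for y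
      using linear_neg[OF bounded_linear.linear[OF lin[OF N]]] .
    then show ?case using Suc S_commute[OF N NR, of "(N ^^ n) u"] NR by simp
  qed (simp add: Su)
  have "norm (N y) \<le> c * norm y" if "S y = - R y" for y
  proof -
    have "Re (cinner (R y) y) \<le> 0" using S_pos[of y] that by (simp add: cinner_minus_left)
    then have "(norm (N y))\<^sup>2 \<le> (c * norm y)\<^sup>2" by (simp add: R_quad power_mult_distrib)
    then show ?thesis using c by (simp add: power2_le_iff_abs_le)
  qed
  with kernel have step: "norm (N ((N ^^ n) u)) \<le> c * norm ((N ^^ n) u)" for n by blast
  have "norm ((N ^^ n) u) \<le> c ^ n * norm u" for n
  proof (induction n)
    case (Suc n)
    have "norm ((N ^^ Suc n) u) \<le> c * norm ((N ^^ n) u)" using step by simp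
    also have "\<dots> \<le> c * (c ^ n * norm u)" using Suc c by (simp add: mult_left_mono)
    finally show ?case by (simp add: mult.assoc)
  qed simp
  \<comment> \<open>If \<open>u\<close> vanished, the form of \<open>R\<close> at \<open>w\<close>
    would equal that of \<open>S\<close> and be nonnegative, against the choice of
    \<open>w\<close>.\<close>
  moreover have "u \<noteq> 0"
  proof
    assume "u = 0"
    then have "S w = R w" by (simp add: u_def)
    then have "c\<^sup>2 * (norm w)\<^sup>2 \<le> (norm (N w))\<^sup>2" using S_pos[of w] by (simp add: R_quad)
    moreover have "(norm (N w))\<^sup>2 < (c * norm w)\<^sup>2" using w by (intro power_strict_mono) auto
    ultimately show False by (simp add: power_mult_distrib)
  qed
  ultimately show ?thesis by blast
qed

text \<open>Polarizing the vanishing form of \<open>T - m\<close> gives an antisymmetry; replacing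
  \<open>y\<close> by i \<open>y\<close> flips one sign and forces zero.\<close>

lemma scalar_of_constant_quadratic_form:
  fixes T :: "'a::complex_inner \<Rightarrow> 'a"
  assumes T: "bounded_clinear T" and quad: "\<And>x. cinner (T x) x = m * cinner x x"
  shows "T x = m *\<^sub>C x"
proof -
  define A where "A = (\<lambda>x. T x - m *\<^sub>C x)"
  have A: "bounded_clinear A"
    unfolding A_def by (intro bounded_clinear_minus T bounded_clinear_scale bounded_clinear_id)
  have zero: "cinner (A x) x = 0" for x
    by (simp add: A_def cinner_diff_left cinner_scaleC_left quad)
  have anti: "cinner (A x) y + cinner (A y) x = 0" for x y
    using zero[of "x + y"]
    by (simp add: bounded_clinear_add[OF A] cinner_add_left cinner_add_right zero add.commute)
  have "cinner (A x) y = 0" for y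
    using anti[of x y] anti[of x "\<i> *\<^sub>C y"]
    by (simp add: bounded_clinear_scaleC[OF A] cinner_scaleC_left cinner_scaleC_right)
  then have "A x = 0" by (intro cinner_ext) simp
  then show ?thesis by (simp add: A_def)
qed

lemma normal_hyperinvariant:
  fixes T :: "'a::chilbert_space \<Rightarrow> 'a"
  assumes T: "bounded_clinear T" and normal: "\<And>x. cadjoint T (T x) = T (cadjoint T x)"
    and nonscalar: "\<not> (\<exists>c. \<forall>x. T x = c *\<^sub>C x)"
  shows "\<exists>M. csubspace M \<and> closed M \<and> hyperinvariant T M \<and> M \<noteq> {0} \<and> M \<noteq> UNIV"
proof -
  have "\<exists>d v w. norm v = 1 \<and> norm w = 1 \<and> norm (T w - d *\<^sub>C w) < norm (T v - d *\<^sub>C v)"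
  proof (rule ccontr)
    assume "\<not> ?thesis"
    then have eq: "norm (T v - d *\<^sub>C v) = norm (T w - d *\<^sub>C w)" if "norm v = 1" "norm w = 1" for v w d
      using that by (meson linorder_neqE)
    \<comment> \<open>Comparing \<open>d\<close> with 0 isolates the term linear in conjugate
      \<open>d\<close>; the values 1 and i then read off both parts of the quadratic form.\<close>
    have expand: "(norm (T v - d *\<^sub>C v))\<^sup>2 = (norm (T v))\<^sup>2 + (cmod d)\<^sup>2 - 2 * Re (cnj d * cinner (T v) v)"
      if "norm v = 1" for v d
      using norm_add_sq[of "T v" "(- d) *\<^sub>C v"] that
      by (simp add: norm_scaleC cinner_minus_right cinner_scaleC_right)
    have const: "cinner (T v) v = cinner (T w) w" if vw: "norm v = 1" "norm w = 1" for v w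
    proof -
      have "Re (cnj d * cinner (T v) v) = Re (cnj d * cinner (T w) w)" for d
        using eq[OF vw, of d] eq[OF vw, of 0] expand[of v d] expand[of w d] vw by simp
      from this[of 1] this[of \<i>] show ?thesis by (simp add: complex_eq_iff)
    qed
    obtain x0 where "T x0 \<noteq> 0 *\<^sub>C x0" using nonscalar by blast
    then have "x0 \<noteq> 0" using bounded_clinear_diff[OF T, of x0 x0] by auto
    define v where "v = x0 /\<^sub>R norm x0"
    have v: "norm v = 1" using \<open>x0 \<noteq> 0\<close> by (simp add: v_def)
    have "cinner (T x) x = cinner (T v) v * cinner x x" for x
    proof (cases "x = 0")
      case False
      define y where "y = x /\<^sub>R norm x"
      have "norm y = 1" using False by (simp add: y_def)
      moreover have x: "x = complex_of_real (norm x) *\<^sub>C y" using False by (simp add: y_def scaleC_of_real)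
      ultimately show ?thesis
        using const[OF \<open>norm y = 1\<close> v] bounded_clinear_scaleC[OF T, of "complex_of_real (norm x)" y]
          cinner_scaleC_left[of "complex_of_real (norm x)" "T y" x]
          cinner_scaleC_right[of "T y" "complex_of_real (norm x)" y]
        by (simp add: cinner_self power2_eq_square flip: x)
    qed simp
    then show False using scalar_of_constant_quadratic_form[OF T] nonscalar by blast
  qed
  then obtain d v w where vw: "norm v = 1" "norm w = 1" "norm (T w - d *\<^sub>C w) < norm (T v - d *\<^sub>C v)"
    by blast
  define N where "N = (\<lambda>x. T x - d *\<^sub>C x)"
  have N: "bounded_clinear N"
    unfolding N_def by (intro bounded_clinear_minus T bounded_clinear_scale bounded_clinear_id)
  have adj: "cadjoint N = (\<lambda>y. cadjoint T y - cnj d *\<^sub>C y)"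
    by (rule cadjoint_unique)
      (simp add: N_def cinner_diff_left cinner_diff_right cinner_scaleC_left cinner_scaleC_right
        cinner_cadjoint[OF T])
  note T' = bounded_clinear_cadjoint[OF T]
  have N_normal: "cadjoint N (N x) = N (cadjoint N x)" for x
    unfolding adj
    by (simp add: N_def bounded_clinear_diff[OF T] bounded_clinear_diff[OF T'] bounded_clinear_scaleC[OF T]
        bounded_clinear_scaleC[OF T'] normal complex_vector.scale_right_diff_distrib scaleC_scaleC mult.commute)
  \<comment> \<open>Equal lengths under \<open>N\<close> and its adjoint yield the inequality behind
    log-convexity.\<close>
  have norm_adj: "norm (cadjoint N x) = norm (N x)" for x
  proof -
    have "complex_of_real ((norm (cadjoint N x))\<^sup>2) = complex_of_real ((norm (N x))\<^sup>2)"
      unfolding cinner_self[symmetric]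
      by (simp add: cinner_cadjoint_left[OF N] N_normal flip: cinner_cadjoint[OF N])
        (simp add: cinner_cadjoint_left[OF N] flip: N_normal)
    then show ?thesis by (metis norm_ge_zero of_real_eq_iff power2_eq_iff_nonneg)
  qed
  have paranormal: "(norm (N x))\<^sup>2 \<le> norm (N (N x)) * norm x" for x
  proof -
    have "(norm (N x))\<^sup>2 = Re (cinner (cadjoint N (N x)) x)"
      by (simp add: cinner_cadjoint_left[OF N] Re_cinner_self)
    also have "\<dots> \<le> norm (cadjoint N (N x)) * norm x" by (rule Re_cinner_le)
    finally show ?thesis by (simp add: norm_adj)
  qed
  \<comment> \<open>At this level \<open>w\<close> makes the slow subspace nonzero, while
    \<open>v\<close> violates its bound at exponent 1.\<close>
  define c where "c = (norm (N v) + norm (N w)) / 2"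
  have lt: "norm (N w) < norm (N v)" using vw by (simp add: N_def)
  then have c: "norm (N w) < c" "c < norm (N v)"
    by (simp_all add: c_def)
  then have c_pos: "0 < c"
    using norm_ge_zero[of "N w"] by linarith
  define M where "M = {x. \<forall>n. norm ((N ^^ n) x) \<le> c ^ n * norm x}"
  have M: "csubspace M" "closed M" "hyperinvariant N M"
    unfolding M_def by (rule growth_subspace[OF N paranormal c_pos])+
  have "hyperinvariant T M"
    unfolding hyperinvariant_def
  proof (intro allI impI)
    fix S assume S: "bounded_clinear S \<and> S \<circ> T = T \<circ> S"
    then have "S \<circ> N = N \<circ> S"
      by (simp add: N_def bounded_clinear_diff bounded_clinear_scaleC fun_eq_iff)
    then show "S ` M \<subseteq> M" using M(3) S by (simp add: hyperinvariant_def)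
  qed
  moreover have "M \<noteq> {0}"
    using normal_slow_vector[OF N N_normal c_pos, of w] c vw by (auto simp: M_def)
  moreover have "v \<notin> M"
    using c vw by (auto simp: M_def intro!: exI[of _ 1])
  ultimately show ?thesis using M by blast
qed

section \<open>Recurrences and linear systems\<close>

text \<open>Summing the inequality and absorbing the fraction \<open>p + q\<close> < 1 of the
  partial sum into the left side bounds all partial sums.\<close>

lemma summable_three_term:
  fixes w h :: "nat \<Rightarrow> real"
  assumes w: "\<And>n. 0 \<le> w n" and h: "\<And>n. 0 \<le> h n" "summable h"
    and pq: "0 \<le> p" "0 \<le> q" "p + q < 1" and N: "1 \<le> N"
    and step: "\<And>n. N \<le> n \<Longrightarrow> w (Suc n) \<le> h n + p * w n + q * w (n - 1)"
  shows "summable w"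
proof -
  define C where "C = (sum w {..N} + suminf h) / (1 - (p + q))"
  have bound: "sum w {..M} \<le> C" if M: "N \<le> M" for M
  proof -
    have "{..M} = {..N} \<union> Suc ` {N..<M}" using M by (auto simp: image_Suc_atLeastLessThan)
    then have "sum w {..M} = sum w {..N} + sum w (Suc ` {N..<M})"
      by (simp only:) (rule sum.union_disjoint, auto)
    also have "sum w (Suc ` {N..<M}) = (\<Sum>n=N..<M. w (Suc n))"
      by (subst sum.reindex) auto
    also have "(\<Sum>n=N..<M. w (Suc n)) \<le> (\<Sum>n=N..<M. h n + p * w n + q * w (n - 1))"
      by (intro sum_mono step) simp
    also have "\<dots> = sum h {N..<M} + p * sum w {N..<M} + q * (\<Sum>n=N..<M. w (n - 1))"
      by (simp add: sum.distrib sum_distrib_left)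
    also have "\<dots> \<le> suminf h + p * sum w {..M} + q * sum w {..M}"
    proof (intro add_mono mult_left_mono pq)
      show "sum h {N..<M} \<le> suminf h" by (intro sum_le_suminf h) auto
      show "sum w {N..<M} \<le> sum w {..M}" by (intro sum_mono2 w) auto
      have "(\<Sum>n=N..<M. w (n - 1)) = sum w ((\<lambda>n. n - 1) ` {N..<M})"
        using N by (subst sum.reindex) (auto simp: inj_on_def)
      also have "\<dots> \<le> sum w {..M}" by (intro sum_mono2 w) auto
      finally show "(\<Sum>n=N..<M. w (n - 1)) \<le> sum w {..M}" .
    qed
    finally have "sum w {..M} * (1 - (p + q)) \<le> sum w {..N} + suminf h"
      by (simp add: algebra_simps)
    then show ?thesis using pq by (simp add: C_def pos_le_divide_eq)
  qed
  show ?thesis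
  proof (rule summableI_nonneg_bounded[OF w])
    fix n
    have "sum w {..<n} \<le> sum w {..max n N}" by (intro sum_mono2 w) auto
    also have "\<dots> \<le> C" by (intro bound) simp
    finally show "sum w {..<n} \<le> C" .
  qed
qed

text \<open>Gaussian elimination: equation \<open>m\<close> determines the unknown \<open>p\<close>,
  leaving \<open>m\<close> equations in one unknown fewer.\<close>

lemma homogeneous_system_nontrivial:
  fixes A :: "nat \<Rightarrow> 'k \<Rightarrow> 'f::field"
  assumes "finite K" "m < card K"
  shows "\<exists>c. (\<exists>k\<in>K. c k \<noteq> 0) \<and> (\<forall>n<m. (\<Sum>k\<in>K. c k * A n k) = 0)"
  using assms
proof (induction m arbitrary: K A)
  case 0
  then obtain k where "k \<in> K" by fastforce
  then show ?case by (intro exI[of _ "\<lambda>_. 1"]) auto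
next
  case (Suc m)
  show ?case
  proof (cases "\<forall>k\<in>K. A m k = 0")
    case True
    obtain c where c: "\<exists>k\<in>K. c k \<noteq> 0" "\<forall>n<m. (\<Sum>k\<in>K. c k * A n k) = 0"
      using Suc.IH[of K A] Suc.prems by auto
    then show ?thesis using True by (intro exI[of _ c]) (auto simp: less_Suc_eq)
  next
    case False
    then obtain p where p: "p \<in> K" "A m p \<noteq> 0" by blast
    define A' where "A' n k = A n k - A n p * A m k / A m p" for n k
    have "m < card (K - {p})" using Suc.prems p by simp
    then obtain c where c: "\<exists>k\<in>K - {p}. c k \<noteq> 0" "\<forall>n<m. (\<Sum>k\<in>K - {p}. c k * A' n k) = 0"
      using Suc.IH[of "K - {p}" A'] Suc.prems by auto
    define s where "s = (\<Sum>k\<in>K - {p}. c k * A m k)"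
    define c' where "c' = c(p := - s / A m p)"
    have sum: "(\<Sum>k\<in>K. c' k * A n k) = (\<Sum>k\<in>K - {p}. c k * A n k) - s / A m p * A n p" for n
    proof -
      have "(\<Sum>k\<in>K. c' k * A n k) = c' p * A n p + (\<Sum>k\<in>K - {p}. c' k * A n k)"
        using Suc.prems p by (intro sum.remove) auto
      also have "(\<Sum>k\<in>K - {p}. c' k * A n k) = (\<Sum>k\<in>K - {p}. c k * A n k)"
        by (intro sum.cong) (auto simp: c'_def)
      finally show ?thesis by (simp add: c'_def)
    qed
    have "(\<Sum>k\<in>K. c' k * A n k) = 0" if "n < Suc m" for n
    proof (cases "n = m")
      case True
      then show ?thesis using p by (simp add: sum s_def)
    next
      case False
      have "(\<Sum>k\<in>K - {p}. c k * A' n k) = (\<Sum>k\<in>K - {p}. c k * A n k) - (\<Sum>k\<in>K - {p}. c k * A m k * (A n p / A m p))"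
        by (simp add: A'_def sum_subtractf right_diff_distrib mult_ac)
      also have "(\<Sum>k\<in>K - {p}. c k * A m k * (A n p / A m p)) = s / A m p * A n p"
        by (simp add: s_def sum_distrib_right sum_divide_distrib)
      finally show ?thesis using c(2) False that by (simp add: sum)
    qed
    moreover have "\<exists>k\<in>K. c' k \<noteq> 0" using c(1) by (auto simp: c'_def)
    ultimately show ?thesis by blast
  qed
qed

text \<open>Values up to index \<open>N\<close> are free. \<open>F\<close> receives the index of the
  equation, which is one less than that of the value it produces.\<close>

fun three_term :: "(nat \<Rightarrow> 'b \<Rightarrow> 'b \<Rightarrow> 'b) \<Rightarrow> (nat \<Rightarrow> 'b) \<Rightarrow> nat \<Rightarrow> nat \<Rightarrow> 'b" where
  "three_term F f N j =
    (if j \<le> N then f j else F (j - 1) (three_term F f N (j - 1)) (three_term F f N (j - 2)))"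

declare three_term.simps [simp del]

text \<open>Convexity of the square with weights \<open>\<eta>\<close>, \<open>\<eta>\<close>,
  \<open>\<theta>\<close>, after writing \<open>\<gamma>\<close> as a multiple of
  \<open>\<eta>\<close>. The coefficients of \<open>u\<close> and \<open>v\<close> survive squaring,
  so a recurrence stays contractive for squares.\<close>

lemma weighted_square_le:
  fixes \<eta> \<theta> \<gamma> u v :: real
  assumes "0 < \<eta>" "0 \<le> \<theta>" "2 * \<eta> + \<theta> \<le> 1"
  shows "(\<gamma> + \<eta> * u + \<theta> * v)\<^sup>2 \<le> \<gamma>\<^sup>2 / \<eta> + \<eta> * u\<^sup>2 + \<theta> * v\<^sup>2"
proof -
  define z where "z = \<gamma> / \<eta>"
  have g: "\<gamma> = \<eta> * z" using assms by (simp add: z_def)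
  let ?S = "\<eta> * z\<^sup>2 + \<eta> * u\<^sup>2 + \<theta> * v\<^sup>2"
  have "0 \<le> \<eta> * \<eta> * (z - u)\<^sup>2 + \<eta> * \<theta> * (z - v)\<^sup>2 + \<eta> * \<theta> * (u - v)\<^sup>2"
    using assms by simp
  then have "(\<gamma> + \<eta> * u + \<theta> * v)\<^sup>2 \<le> (2 * \<eta> + \<theta>) * ?S"
    by (simp add: g power2_eq_square algebra_simps)
  also have "\<dots> \<le> 1 * ?S" using assms by (intro mult_right_mono) auto
  also have "\<dots> = \<gamma>\<^sup>2 / \<eta> + \<eta> * u\<^sup>2 + \<theta> * v\<^sup>2"
    using assms by (simp add: g power2_eq_square)
  finally show ?thesis .
qed

section \<open>Hyponormal operators with a tridiagonal tail\<close>

locale tridiagonal_hyponormal =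
  fixes T :: "'a::chilbert_space \<Rightarrow> 'a" and e :: "nat \<Rightarrow> 'a" and n0 :: nat
  assumes T: "bounded_clinear T" and hyponormal: "hyponormal T" and basis: "orthonormal_basis e"
    and band: "\<And>l n. l \<ge> 2 \<Longrightarrow> n \<ge> n0 \<Longrightarrow>
           cinner (T (e n)) (e (n + l)) = 0 \<and> cinner (cadjoint T (e n)) (e (n + l)) = 0"
begin

definition t :: "nat \<Rightarrow> nat \<Rightarrow> complex" where
  "t j k = cinner (T (e k)) (e j)"

text \<open>The added 1 keeps this bound on the entries positive even for a zero operator.\<close>

definition K :: real where
  "K = onorm T + 1"

definition D :: "'a \<Rightarrow> 'a" where
  "D x = cadjoint T (T x) - T (cadjoint T x)"

definition defect :: "nat \<Rightarrow> real" where
  "defect n = Re (cinner (D (e n)) (e n))"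

definition gap :: "nat \<Rightarrow> real" where
  "gap n = (cmod (t (Suc n) n))\<^sup>2 - (cmod (t n (Suc n)))\<^sup>2"

text \<open>Mass in the rows and columns where the band condition may fail; it enters as a summable
  error.\<close>

definition corner :: "nat \<Rightarrow> real" where
  "corner n = (\<Sum>i<n0. (cmod (t i n))\<^sup>2 + (cmod (t n i))\<^sup>2)"

lemma adjoint_entry: "cinner (cadjoint T (e k)) (e j) = cnj (t k j)"
  unfolding t_def by (metis T cinner_cadjoint cinner_commute)

text \<open>The hypothesis on \<open>T\<close> clears the columns from \<open>n0\<close> on below
  the band; that on the adjoint clears the rows from \<open>n0\<close> on above it.\<close>

lemma t_lower: "n0 \<le> k \<Longrightarrow> k + 2 \<le> j \<Longrightarrow> t j k = 0"
  using band[of "j - k" k] by (simp add: t_def)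

lemma t_upper: "n0 \<le> j \<Longrightarrow> j + 2 \<le> k \<Longrightarrow> t j k = 0"
  using band[of "k - j" j] by (simp add: adjoint_entry)

lemma norm_basis: "norm (e k) = 1"
  using cinner_basis[OF basis, of k k] Re_cinner_self[of "e k"]
  by (simp add: power2_eq_1_iff) (metis norm_ge_zero neg_0_le_iff_le not_one_le_zero)

lemma K_pos: "0 < K"
  using onorm_pos_le[OF bounded_clinear_bounded_linear[OF T]] by (simp add: K_def)

lemma cmod_t_le: "cmod (t j k) \<le> K"
proof -
  have "cmod (t j k) \<le> norm (T (e k)) * norm (e j)"
    unfolding t_def by (rule cmod_cinner_le)
  also have "\<dots> \<le> onorm T"
    using onorm[OF bounded_clinear_bounded_linear[OF T], of "e k"] by (simp add: norm_basis)
  finally show ?thesis by (simp add: K_def)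
qed

lemma parseval_column: "(\<lambda>j. (cmod (t j k))\<^sup>2) sums (norm (T (e k)))\<^sup>2"
  using parseval[OF basis, of "T (e k)"] by (simp add: t_def)

lemma parseval_row: "(\<lambda>j. (cmod (t k j))\<^sup>2) sums (norm (cadjoint T (e k)))\<^sup>2"
  using parseval[OF basis, of "cadjoint T (e k)"] by (simp add: adjoint_entry)

lemma corner_nonneg: "0 \<le> corner n"
  by (auto simp: corner_def intro!: sum_nonneg add_nonneg_nonneg)

lemma summable_corner: "summable corner"
  unfolding corner_def
  by (intro summable_sum summable_add sums_summable[OF parseval_row] sums_summable[OF parseval_column])

section \<open>The self-commutator \<open>D\<close> and its trace\<close>

lemma D_bounded_clinear: "bounded_clinear D"
proof -
  note T' = bounded_clinear_cadjoint[OF T]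
  show ?thesis
    unfolding D_def[abs_def]
    by (rule bounded_clinear_minus[OF bounded_clinear_compose[OF T' T] bounded_clinear_compose[OF T T']])
qed

lemma cinner_D: "cinner (D x) y = cinner (T x) (T y) - cinner (cadjoint T x) (cadjoint T y)"
  by (simp add: D_def cinner_diff_left cinner_cadjoint_left[OF T] cinner_cadjoint[OF T])

lemma D_self: "cinner (D x) y = cinner x (D y)"
  by (metis cinner_D cinner_commute complex_cnj_diff)

lemma D_pos: "0 \<le> Re (cinner (D x) x)"
  using hyponormal unfolding hyponormal_def positive_semidefinite_def D_def
  by (auto simp: complex_nonneg_Reals_iff)

lemma defect_nonneg: "0 \<le> defect n"
  by (simp add: defect_def D_pos)

lemma defect_eq: "defect n = (norm (T (e n)))\<^sup>2 - (norm (cadjoint T (e n)))\<^sup>2"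
  by (simp add: defect_def cinner_D Re_cinner_self)

lemma D_entry_le: "2 * cmod (cinner (D (e j)) (e k)) \<le> defect j + defect k"
  unfolding defect_def by (rule cmod_cinner_positive_le[OF D_bounded_clinear D_self D_pos])

text \<open>The square block of order \<open>m + 1\<close> contributes nothing to the partial trace of \<open>T\<^sup>* T - T T\<^sup>*\<close>,
  so only the entries leaving the block remain; the tails of the first \<open>n0\<close> rows and columns vanish
  in the limit.\<close>

lemma trace_limit: "(\<lambda>m. (\<Sum>k<Suc m. defect k) - gap m) \<longlonglongrightarrow> 0"
proof -
  \<comment> \<open>\<open>p m k\<close> and \<open>q m k\<close> are the squared masses of column
    and row \<open>k\<close> beyond the first \<open>m\<close> entries.\<close>
  define p where "p m k = (norm (T (e k)))\<^sup>2 - (\<Sum>j<m. (cmod (t j k))\<^sup>2)" for m k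
  define q where "q m k = (norm (cadjoint T (e k)))\<^sup>2 - (\<Sum>j<m. (cmod (t k j))\<^sup>2)" for m k
  have p_limit: "(\<lambda>m. p (Suc m) k) \<longlonglongrightarrow> 0" for k
    using tendsto_diff[OF tendsto_const LIMSEQ_Suc[OF parseval_column[of k, unfolded sums_def]],
        of "(norm (T (e k)))\<^sup>2"] by (simp add: p_def)
  have q_limit: "(\<lambda>m. q (Suc m) k) \<longlonglongrightarrow> 0" for k
    using tendsto_diff[OF tendsto_const LIMSEQ_Suc[OF parseval_row[of k, unfolded sums_def]],
        of "(norm (cadjoint T (e k)))\<^sup>2"] by (simp add: q_def)
  have column: "(norm (T (e k)))\<^sup>2 = (\<Sum>j<k + 2. (cmod (t j k))\<^sup>2)" if "n0 \<le> k" for k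
    by (rule sums_unique2[OF parseval_column sums_finite]) (use t_lower that in auto)
  have row: "(norm (cadjoint T (e k)))\<^sup>2 = (\<Sum>j<k + 2. (cmod (t k j))\<^sup>2)" if "n0 \<le> k" for k
    by (rule sums_unique2[OF parseval_row sums_finite]) (use t_upper that in auto)
  have inner: "p (Suc m) k = 0" "q (Suc m) k = 0" if "n0 \<le> k" "k < m" for m k
  proof -
    have "(\<Sum>j<k + 2. (cmod (t j k))\<^sup>2) = (\<Sum>j<Suc m. (cmod (t j k))\<^sup>2)"
      by (rule sum.mono_neutral_left) (use that t_lower in auto)
    then show "p (Suc m) k = 0" by (simp only: p_def column[OF that(1)])
    have "(\<Sum>j<k + 2. (cmod (t k j))\<^sup>2) = (\<Sum>j<Suc m. (cmod (t k j))\<^sup>2)"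
      by (rule sum.mono_neutral_left) (use that t_upper in auto)
    then show "q (Suc m) k = 0" by (simp only: q_def row[OF that(1)])
  qed
  \<comment> \<open>Column and row \<open>m\<close> leave the block by one entry each, the two
    compared in \<open>gap m\<close>.\<close>
  have last: "p (Suc m) m - q (Suc m) m = gap m" if "n0 \<le> m" for m
    by (simp add: p_def q_def gap_def column[OF that] row[OF that])
  have eq: "(\<Sum>k<Suc m. defect k) - gap m = (\<Sum>k<n0. p (Suc m) k - q (Suc m) k)" if m: "n0 \<le> m" for m
  proof -
    have "(\<Sum>k<Suc m. defect k) = (\<Sum>k<Suc m. (p (Suc m) k - q (Suc m) k) +
        ((\<Sum>j<Suc m. (cmod (t j k))\<^sup>2) - (\<Sum>j<Suc m. (cmod (t k j))\<^sup>2)))"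
      by (intro sum.cong refl) (simp add: defect_eq p_def q_def del: sum.lessThan_Suc)
    also have "\<dots> = (\<Sum>k<Suc m. p (Suc m) k - q (Suc m) k) +
        ((\<Sum>k<Suc m. \<Sum>j<Suc m. (cmod (t j k))\<^sup>2) - (\<Sum>k<Suc m. \<Sum>j<Suc m. (cmod (t k j))\<^sup>2))"
      by (simp only: sum.distrib sum_subtractf)
    also have "(\<Sum>k<Suc m. \<Sum>j<Suc m. (cmod (t j k))\<^sup>2) = (\<Sum>k<Suc m. \<Sum>j<Suc m. (cmod (t k j))\<^sup>2)"
      by (rule sum.swap)
    finally have "(\<Sum>k<Suc m. defect k) = (\<Sum>k<m. p (Suc m) k - q (Suc m) k) + gap m"
      using last[OF m] by simp
    also have "(\<Sum>k<m. p (Suc m) k - q (Suc m) k) = (\<Sum>k<n0. p (Suc m) k - q (Suc m) k)"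
      by (rule sum.mono_neutral_right) (use inner m in auto)
    finally show ?thesis by simp
  qed
  have "(\<lambda>m. \<Sum>k<n0. p (Suc m) k - q (Suc m) k) \<longlonglongrightarrow> (\<Sum>k<n0. 0 - 0)"
    by (intro tendsto_sum tendsto_diff p_limit q_limit)
  then show ?thesis
    unfolding diff_self sum.neutral_const
    by (rule Lim_transform_eventually) (use eq[symmetric] in \<open>blast intro: eventually_sequentiallyI\<close>)
qed

lemma cmod_t_sq_le: "(cmod (t j k))\<^sup>2 \<le> K\<^sup>2"
  by (intro power_mono cmod_t_le) simp

lemma gap_le: "gap n \<le> K\<^sup>2"
  using cmod_t_sq_le[of "Suc n" n] by (simp add: gap_def add_increasing2 diff_le_eq)

text \<open>The partial sums of nonnegative terms stay within bounded distance of
  \<open>gap\<close>, which is bounded above.\<close>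

lemma summable_defect: "summable defect"
proof -
  obtain B where B: "norm ((\<Sum>k<Suc m. defect k) - gap m) \<le> B" for m
    using convergent_imp_Bseq[OF convergentI[OF trace_limit]] by (auto simp: Bseq_def)
  have "sum defect {..<n} \<le> K\<^sup>2 + B" for n
  proof -
    have "sum defect {..<n} \<le> sum defect {..<Suc n}" using defect_nonneg by simp
    also have "\<dots> \<le> K\<^sup>2 + B" using B[of n] gap_le[of n] by (simp add: abs_le_iff)
    finally show ?thesis .
  qed
  then show ?thesis by (intro summableI_nonneg_bounded[OF defect_nonneg])
qed

lemma gap_limit: "gap \<longlonglongrightarrow> suminf defect"
  using tendsto_diff[OF LIMSEQ_Suc[OF summable_LIMSEQ[OF summable_defect]] trace_limit] by simp

text \<open>A zero trace kills the nonnegative diagonal of \<open>D\<close>, and positivity then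
  kills the other entries.\<close>

lemma normal_if_trace_zero:
  assumes "suminf defect = 0"
  shows "cadjoint T (T x) = T (cadjoint T x)"
proof -
  have g0: "defect n = 0" for n
    using suminf_eq_zero_iff[OF summable_defect defect_nonneg] assms by simp
  have "cinner (D (e j)) (e k) = 0" for j k
    using D_entry_le[of j k] by (simp add: g0)
  then have "D (e j) = 0" for j
    by (rule orthonormal_basis_total[OF basis])
  then have "cinner (D x) (e j) = 0" for j
    by (simp add: D_self)
  then have "D x = 0"
    by (rule orthonormal_basis_total[OF basis])
  then show ?thesis by (simp add: D_def)
qed

section \<open>Entries of \<open>D\<close> near the diagonal\<close>

lemma corner_error_le:
  "cmod ((\<Sum>i<n0. t i p * cnj (t i q)) - (\<Sum>i<n0. cnj (t p i) * t q i)) \<le> corner p + corner q"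
proof -
  have mult: "cmod x * cmod y \<le> (cmod x)\<^sup>2 + (cmod y)\<^sup>2" for x y
    using sum_squares_bound[of "cmod x" "cmod y"] mult_nonneg_nonneg[OF norm_ge_zero[of x] norm_ge_zero[of y]]
    by linarith
  have "cmod ((\<Sum>i<n0. t i p * cnj (t i q)) - (\<Sum>i<n0. cnj (t p i) * t q i)) \<le>
      (\<Sum>i<n0. cmod (t i p) * cmod (t i q) + cmod (t p i) * cmod (t q i))"
    unfolding sum_subtractf[symmetric]
    by (rule sum_norm_le) (rule norm_triangle_le_diff, simp add: norm_mult)
  also have "\<dots> \<le> (\<Sum>i<n0. ((cmod (t i p))\<^sup>2 + (cmod (t i q))\<^sup>2) + ((cmod (t p i))\<^sup>2 + (cmod (t q i))\<^sup>2))"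
    by (intro sum_mono add_mono mult)
  also have "\<dots> = corner p + corner q"
    by (simp add: corner_def sum.distrib)
  finally show ?thesis .
qed

text \<open>Beyond the first \<open>n0\<close> indices only \<open>A\<close> contributes to an entry
  of \<open>D\<close>. Positivity bounds the entry by \<open>defect\<close>, and
  \<open>corner\<close> bounds the rest; both are summable.\<close>

lemma D_entry:
  assumes A: "finite A" "{..<n0} \<inter> A = {}"
    and T: "\<And>i. n0 \<le> i \<Longrightarrow> i \<notin> A \<Longrightarrow> (t i p = 0 \<or> t i q = 0) \<and> (t p i = 0 \<or> t q i = 0)"
  shows "cmod (\<Sum>i\<in>A. t i p * cnj (t i q) - cnj (t p i) * t q i) \<le> (defect p + defect q) / 2 + corner p + corner q"
proof -
  have 1: "cinner (T (e p)) (T (e q)) = (\<Sum>i\<in>{..<n0} \<union> A. t i p * cnj (t i q))"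
    unfolding t_def
    by (rule cinner_finite[OF basis]) (use assms in \<open>auto simp: t_def not_less\<close>)
  have 2: "cinner (cadjoint T (e p)) (cadjoint T (e q)) = (\<Sum>i\<in>{..<n0} \<union> A. cnj (t p i) * t q i)"
    using cinner_finite[OF basis, of "{..<n0} \<union> A" "cadjoint T (e p)" "cadjoint T (e q)"] assms
    by (auto simp: adjoint_entry not_less)
  let ?E = "(\<Sum>i<n0. t i p * cnj (t i q)) - (\<Sum>i<n0. cnj (t p i) * t q i)"
  have "(\<Sum>i\<in>A. t i p * cnj (t i q) - cnj (t p i) * t q i) = cinner (D (e p)) (e q) - ?E"
    unfolding cinner_D 1 2 using A by (simp add: sum.union_disjoint sum_subtractf)
  then have "cmod (\<Sum>i\<in>A. t i p * cnj (t i q) - cnj (t p i) * t q i) \<le> cmod (cinner (D (e p)) (e q)) + cmod ?E"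
    by (simp only: norm_triangle_ineq4)
  also have "\<dots> \<le> (defect p + defect q) / 2 + (corner p + corner q)"
    by (intro add_mono corner_error_le) (use D_entry_le[of p q] in simp)
  finally show ?thesis by (simp add: add.assoc)
qed

text \<open>Within the band the indices n and n + 2 share only the neighbour n + 1.\<close>

lemma D_second_diagonal:
  assumes n: "n0 \<le> n"
  shows "cmod (t (Suc n) (Suc (Suc n)) * cnj (t (Suc n) n) - cnj (t (Suc (Suc n)) (Suc n)) * t n (Suc n))
    \<le> (defect (Suc (Suc n)) + defect n) / 2 + corner (Suc (Suc n)) + corner n"
proof -
  have "(t i (Suc (Suc n)) = 0 \<or> t i n = 0) \<and> (t (Suc (Suc n)) i = 0 \<or> t n i = 0)"
    if "n0 \<le> i" "i \<notin> {Suc n}" for i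
    using that n by (cases "i \<le> n") (auto intro: t_upper t_lower)
  then show ?thesis
    using D_entry[of "{Suc n}" "Suc (Suc n)" n] n by simp
qed

lemma D_first_diagonal:
  assumes n: "n0 \<le> n"
  defines "\<Delta> \<equiv> t (Suc n) (Suc n) - t n n"
  shows "cmod (cnj (t (Suc n) n) * \<Delta> - t n (Suc n) * cnj \<Delta>) \<le> (defect (Suc n) + defect n) / 2 + corner (Suc n) + corner n"
proof -
  have "(t i (Suc n) = 0 \<or> t i n = 0) \<and> (t (Suc n) i = 0 \<or> t n i = 0)"
    if "n0 \<le> i" "i \<notin> {n, Suc n}" for i
    using that n by (cases "i < n") (auto intro: t_upper t_lower)
  then have "cmod (\<Sum>i\<in>{n, Suc n}. t i (Suc n) * cnj (t i n) - cnj (t (Suc n) i) * t n i)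
      \<le> (defect (Suc n) + defect n) / 2 + corner (Suc n) + corner n"
    using n by (intro D_entry) auto
  also have "(\<Sum>i\<in>{n, Suc n}. t i (Suc n) * cnj (t i n) - cnj (t (Suc n) i) * t n i) =
      cnj (t (Suc n) n) * \<Delta> - t n (Suc n) * cnj \<Delta>"
    by (simp add: \<Delta>_def algebra_simps)
  finally show ?thesis .
qed

text \<open>Eventually \<open>gap\<close> exceeds half the trace, which keeps the two off-diagonal
  moduli apart. The first diagonal of \<open>D\<close> then bounds the diagonal increments by a
  summable sequence.\<close>

lemma convergent_diagonal:
  assumes pos: "0 < suminf defect"
  shows "\<exists>d. (\<lambda>n. t n n) \<longlonglongrightarrow> d"
proof -
  define \<delta> where "\<delta> = suminf defect"
  define E where "E n = (defect (Suc n) + defect n) / 2 + corner (Suc n) + corner n" for n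
  have "summable E"
    unfolding E_def
    by (intro summable_add summable_divide summable_defect summable_corner; subst summable_Suc_iff;
        rule summable_defect summable_corner)
  then have major: "summable (\<lambda>n. 4 * K / \<delta> * E n)" by (rule summable_mult)
  have "\<forall>\<^sub>F n in sequentially. \<delta> / 2 < gap n"
    using pos by (intro order_tendstoD(1)[OF gap_limit]) (simp add: \<delta>_def)
  then have "\<forall>\<^sub>F n in sequentially. norm (t (Suc n) (Suc n) - t n n) \<le> 4 * K / \<delta> * E n"
    using eventually_ge_at_top[of n0]
  proof eventually_elim
    case (elim n)
    let ?a = "cmod (t (Suc n) n)" and ?b = "cmod (t n (Suc n))"
      and ?d = "t (Suc n) (Suc n) - t n n"
    have prod: "(?a - ?b) * (?a + ?b) = gap n"
      by (simp add: gap_def power2_eq_square algebra_simps)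
    have sn: "0 < gap n" "\<delta> < 2 * gap n" using elim pos by (simp_all add: \<delta>_def)
    have gap: "0 \<le> ?a - ?b"
    proof (rule ccontr)
      assume "\<not> 0 \<le> ?a - ?b"
      then have "(?a - ?b) * (?a + ?b) \<le> 0" by (intro mult_nonpos_nonneg) auto
      then show False using prod sn by simp
    qed
    have "gap n \<le> (?a - ?b) * (2 * K)"
      unfolding prod[symmetric] using gap cmod_t_le[of "Suc n" n] cmod_t_le[of n "Suc n"]
      by (intro mult_left_mono) auto
    then have "\<delta> \<le> 4 * K * (?a - ?b)" using sn by (simp add: algebra_simps)
    then have "\<delta> * cmod ?d \<le> 4 * K * (?a - ?b) * cmod ?d" by (intro mult_right_mono) auto
    also have "\<dots> = 4 * K * (cmod (cnj (t (Suc n) n) * ?d) - cmod (t n (Suc n) * cnj ?d))"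
      by (simp only: norm_mult complex_mod_cnj) (simp add: algebra_simps)
    also have "\<dots> \<le> 4 * K * cmod (cnj (t (Suc n) n) * ?d - t n (Suc n) * cnj ?d)"
      using K_pos by (intro mult_left_mono norm_triangle_ineq2) auto
    also have "\<dots> \<le> 4 * K * E n"
      unfolding E_def using K_pos by (intro mult_left_mono D_first_diagonal elim) auto
    finally show ?case using pos by (simp add: \<delta>_def field_simps)
  qed
  then have "summable (\<lambda>n. t (Suc n) (Suc n) - t n n)"
    using major by (rule summable_comparison_test_ev)
  then have "(\<lambda>n. \<Sum>k<n. t (Suc k) (Suc k) - t k k) \<longlonglongrightarrow> (\<Sum>n. t (Suc n) (Suc n) - t n n)"
    by (rule summable_LIMSEQ)
  then have "(\<lambda>n. t n n - t 0 0) \<longlonglongrightarrow> (\<Sum>n. t (Suc n) (Suc n) - t n n)"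
    by (simp only: sum_lessThan_telescope[of "\<lambda>k. t k k"])
  from tendsto_add[OF this tendsto_const[of "t 0 0"]] show ?thesis by auto
qed

text \<open>Eliminating \<open>cmod (t n (n + 1))\<^sup>2\<close> by means of \<open>gap n\<close>, the vanishing of the second diagonal of \<open>D\<close>
  says that \<open>cmod (t (n + 1) n)\<^sup>2\<close> varies slowly.\<close>

lemma off_diagonal_limit:
  assumes pos: "0 < suminf defect"
  shows "(\<lambda>n. (cmod (t n (Suc n)))\<^sup>2 - (cmod (t (Suc (Suc n)) (Suc n)))\<^sup>2) \<longlonglongrightarrow> - suminf defect"
proof -
  define \<delta> where "\<delta> = suminf defect"
  define a where "a n = (cmod (t (Suc n) n))\<^sup>2" for n
  define b where "b n = (cmod (t n (Suc n)))\<^sup>2" for n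
  define E where "E n = (defect (Suc (Suc n)) + defect n) / 2 + corner (Suc (Suc n)) + corner n" for n
  have g0: "defect \<longlonglongrightarrow> 0" and r0: "corner \<longlonglongrightarrow> 0"
    by (rule summable_LIMSEQ_zero summable_defect summable_corner)+
  have "E \<longlonglongrightarrow> (0 + 0) / 2 + 0 + 0"
    unfolding E_def by (intro tendsto_intros g0 r0 LIMSEQ_Suc) auto
  then have E0: "E \<longlonglongrightarrow> 0" by simp
  have a: "0 \<le> a n" "a n \<le> K\<^sup>2" for n by (simp_all add: a_def cmod_t_sq_le)
  have b: "b n = a n - gap n" for n by (simp add: a_def b_def gap_def)
  \<comment> \<open>A difference of squares built from the two products in the second diagonal of
    \<open>D\<close>.\<close>
  have x: "\<bar>b (Suc n) * a n - b n * a (Suc n)\<bar> \<le> E n * (2 * K\<^sup>2)" if n: "n0 \<le> n" for n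
  proof -
    let ?u = "t (Suc n) (Suc (Suc n)) * cnj (t (Suc n) n)"
      and ?v = "cnj (t (Suc (Suc n)) (Suc n)) * t n (Suc n)"
    have "b (Suc n) * a n - b n * a (Suc n) = (cmod ?u - cmod ?v) * (cmod ?u + cmod ?v)"
      by (simp add: a_def b_def norm_mult power2_eq_square algebra_simps)
    then have "\<bar>b (Suc n) * a n - b n * a (Suc n)\<bar> = \<bar>cmod ?u - cmod ?v\<bar> * (cmod ?u + cmod ?v)"
      by (simp add: abs_mult)
    also have "\<dots> \<le> cmod (?u - ?v) * (2 * K\<^sup>2)"
    proof (rule mult_mono)
      have "cmod ?u \<le> K * K" "cmod ?v \<le> K * K"
        using K_pos by (simp_all add: norm_mult mult_mono cmod_t_le)
      then show "cmod ?u + cmod ?v \<le> 2 * K\<^sup>2" by (simp add: power2_eq_square)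
    qed (auto intro: norm_triangle_ineq3)
    also have "\<dots> \<le> E n * (2 * K\<^sup>2)"
      unfolding E_def by (intro mult_right_mono D_second_diagonal n) simp
    finally show ?thesis .
  qed
  have "(\<lambda>n. \<delta> * (a (Suc n) - a n)) \<longlonglongrightarrow> 0"
  proof (rule Lim_null_comparison)
    have gap: "(\<lambda>n. \<bar>gap n - \<delta>\<bar>) \<longlonglongrightarrow> 0"
      using tendsto_rabs[OF tendsto_diff[OF gap_limit tendsto_const[of "suminf defect"]]] by (simp add: \<delta>_def)
    have "(\<lambda>n. E n * (2 * K\<^sup>2) + \<bar>gap n - \<delta>\<bar> * K\<^sup>2 + \<bar>gap (Suc n) - \<delta>\<bar> * K\<^sup>2)
        \<longlonglongrightarrow> 0 * (2 * K\<^sup>2) + 0 * K\<^sup>2 + 0 * K\<^sup>2"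
      by (intro tendsto_add tendsto_mult_right E0 gap LIMSEQ_Suc[OF gap])
    then show "(\<lambda>n. E n * (2 * K\<^sup>2) + \<bar>gap n - \<delta>\<bar> * K\<^sup>2 + \<bar>gap (Suc n) - \<delta>\<bar> * K\<^sup>2) \<longlonglongrightarrow> 0" by simp
    show "\<forall>\<^sub>F n in sequentially. norm (\<delta> * (a (Suc n) - a n)) \<le>
        E n * (2 * K\<^sup>2) + \<bar>gap n - \<delta>\<bar> * K\<^sup>2 + \<bar>gap (Suc n) - \<delta>\<bar> * K\<^sup>2"
    proof (rule eventually_sequentiallyI[of n0])
      fix n assume n: "n0 \<le> n"
      have "\<delta> * (a (Suc n) - a n) =
          (b (Suc n) * a n - b n * a (Suc n)) - (gap n - \<delta>) * a (Suc n) + (gap (Suc n) - \<delta>) * a n"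
        by (simp add: b algebra_simps)
      also have "\<bar>\<dots>\<bar> \<le> \<bar>b (Suc n) * a n - b n * a (Suc n)\<bar> + \<bar>(gap n - \<delta>) * a (Suc n)\<bar>
          + \<bar>(gap (Suc n) - \<delta>) * a n\<bar>"
        by linarith
      also have "\<dots> \<le> E n * (2 * K\<^sup>2) + \<bar>gap n - \<delta>\<bar> * K\<^sup>2 + \<bar>gap (Suc n) - \<delta>\<bar> * K\<^sup>2"
        using a by (intro add_mono x n) (auto simp: abs_mult intro!: mult_left_mono)
      finally show "norm (\<delta> * (a (Suc n) - a n)) \<le>
          E n * (2 * K\<^sup>2) + \<bar>gap n - \<delta>\<bar> * K\<^sup>2 + \<bar>gap (Suc n) - \<delta>\<bar> * K\<^sup>2" by simp
    qed
  qed
  from tendsto_divide[OF this tendsto_const[of \<delta>]] have "(\<lambda>n. a (Suc n) - a n) \<longlonglongrightarrow> 0"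
    using pos by (simp add: \<delta>_def)
  from tendsto_diff[OF tendsto_minus[OF this] gap_limit] show ?thesis
    unfolding a_def[symmetric] b_def[symmetric] b by (simp add: algebra_simps)
qed

text \<open>The column equations with index at least \<open>N\<close> of the eigenvalue problem for \<open>T\<^sup>*\<close> form a
  three-term recurrence; its dominant coefficient is \<open>t (n + 1) n\<close>, so every solution is square
  summable, whatever its first \<open>N + 1\<close> coordinates.\<close>

lemma tail_solution:
  assumes pos: "0 < suminf defect" and d: "(\<lambda>n. t n n) \<longlonglongrightarrow> d"
  shows "\<exists>N. \<forall>f. \<exists>x. (\<forall>j\<le>N. cinner x (e j) = f j) \<and> (\<forall>n\<ge>N. cinner (T (e n) - d *\<^sub>C e n) x = 0)"
proof -
  define \<delta> where "\<delta> = suminf defect"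
  have \<delta>: "0 < \<delta>" "\<delta> \<le> K\<^sup>2"
    using pos LIMSEQ_le_const2[OF gap_limit] gap_le by (auto simp: \<delta>_def)
  \<comment> \<open>The squared entry above the diagonal is eventually at most the one below minus
    \<open>\<delta>\<close> / 2, and the latter is at most \<open>K\<^sup>2\<close>; hence
    \<open>\<theta>\<close> bounds the ratio of moduli. A third of the remaining room goes to
    \<open>\<eta>\<close>.\<close>
  define \<theta> where "\<theta> = sqrt (1 - \<delta> / (2 * K\<^sup>2))"
  define \<eta> where "\<eta> = (1 - \<theta>) / 3"
  have \<theta>: "0 \<le> \<theta>" "\<theta> < 1" "\<theta>\<^sup>2 = 1 - \<delta> / (2 * K\<^sup>2)"
    using \<delta> K_pos by (simp_all add: \<theta>_def field_simps)
  have \<eta>: "0 < \<eta>" "2 * \<eta> + \<theta> \<le> 1" "\<eta> + \<theta> < 1"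
    using \<theta> by (simp_all add: \<eta>_def field_simps)
  \<comment> \<open>An eventual lower bound for the modulus of the dominant coefficient, since
    \<open>gap\<close> exceeds \<open>\<delta>\<close> / 2.\<close>
  define \<alpha> where "\<alpha> = sqrt (\<delta> / 2)"
  have \<alpha>: "0 < \<alpha>" "\<alpha>\<^sup>2 = \<delta> / 2" using \<delta> by (simp_all add: \<alpha>_def)
  have ev_s: "\<forall>\<^sub>F n in sequentially. \<delta> / 2 < gap n"
    using pos by (intro order_tendstoD(1)[OF gap_limit]) (simp add: \<delta>_def)
  have ev_b: "\<forall>\<^sub>F n in sequentially. (cmod (t n (Suc n)))\<^sup>2 - (cmod (t (Suc (Suc n)) (Suc n)))\<^sup>2 < - \<delta> / 2"
    using pos by (intro order_tendstoD(2)[OF off_diagonal_limit]) (simp_all add: \<delta>_def)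
  have "0 < \<eta> * \<alpha>" using \<eta> \<alpha> by simp
  with d have ev_d: "\<forall>\<^sub>F n in sequentially. cmod (t n n - d) < \<eta> * \<alpha>"
    by (simp add: tendsto_iff dist_norm)
  from eventually_conj[OF ev_s eventually_conj[OF ev_b ev_d]] obtain M where
    M: "\<And>n. M \<le> n \<Longrightarrow> \<delta> / 2 < gap n"
      "\<And>n. M \<le> n \<Longrightarrow> (cmod (t n (Suc n)))\<^sup>2 - (cmod (t (Suc (Suc n)) (Suc n)))\<^sup>2 < - \<delta> / 2"
      "\<And>n. M \<le> n \<Longrightarrow> cmod (t n n - d) < \<eta> * \<alpha>"
    unfolding eventually_sequentially by blast
  \<comment> \<open>The successor lets n - 1 pass both thresholds as well.\<close>
  define N where "N = Suc (max M n0)"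
  have N: "M < N" "n0 < N" by (auto simp: N_def)
  have a_ge: "\<alpha> \<le> cmod (t (Suc n) n)" if "N \<le> n" for n
  proof -
    have "\<alpha>\<^sup>2 \<le> (cmod (t (Suc n) n))\<^sup>2"
      using M(1)[of n] that N zero_le_power2[of "cmod (t n (Suc n))"] unfolding \<alpha>(2) gap_def by linarith
    then show ?thesis by (rule power2_le_imp_le) simp
  qed
  have d_le: "cmod (t n n - d) \<le> \<eta> * cmod (t (Suc n) n)" if "N \<le> n" for n
    using M(3)[of n] that N mult_left_mono[OF a_ge[OF that] less_imp_le[OF \<eta>(1)]] by simp
  have b_le: "cmod (t (n - 1) n) \<le> \<theta> * cmod (t (Suc n) n)" if n: "N \<le> n" for n
  proof -
    obtain k where k: "n = Suc k" "M \<le> k" using n N by (cases n) auto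
    let ?a = "(cmod (t (Suc n) n))\<^sup>2"
    have "\<delta> / (2 * K\<^sup>2) * ?a \<le> \<delta> / (2 * K\<^sup>2) * K\<^sup>2"
      using \<delta> by (intro mult_left_mono cmod_t_sq_le) simp
    also have "\<dots> = \<delta> / 2" using K_pos by simp
    finally have "(cmod (t k n))\<^sup>2 \<le> (1 - \<delta> / (2 * K\<^sup>2)) * ?a"
      using M(2)[OF k(2)] k by (simp add: left_diff_distrib)
    then have "(cmod (t k n))\<^sup>2 \<le> (\<theta> * cmod (t (Suc n) n))\<^sup>2"
      by (simp add: power_mult_distrib \<theta>(3))
    then show ?thesis using k \<theta>(1) by (auto intro: power2_le_imp_le)
  qed
  have "\<exists>x. (\<forall>j\<le>N. cinner x (e j) = f j) \<and> (\<forall>n\<ge>N. cinner (T (e n) - d *\<^sub>C e n) x = 0)" for f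
  proof -
    \<comment> \<open>The first \<open>n0\<close> rows meet prescribed coordinates only, so they
      give an inhomogeneous term.\<close>
    define G where "G n = (\<Sum>j<n0. t j n * cnj (f j))" for n
    define F where "F n u v = - (G n + (t n n - d) * u + t (n - 1) n * v) / t (Suc n) n" for n u v
    \<comment> \<open>The inner product is conjugate-linear in its second argument, so the
      recurrence runs on conjugated coordinates.\<close>
    define y where "y = three_term F (\<lambda>j. cnj (f j)) N"
    have y_init: "y j = cnj (f j)" if "j \<le> N" for j
      using that by (simp add: y_def three_term.simps)
    have y_Suc: "y (Suc n) = F n (y n) (y (n - 1))" if "N \<le> n" for n
      using that by (simp add: y_def three_term.simps[of F _ N "Suc n"] numeral_2_eq_2)
    have a_nonzero: "t (Suc n) n \<noteq> 0" if "N \<le> n" for n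
      using a_ge[OF that] \<alpha> by auto
    define C where "C = (\<Sum>j<n0. (cmod (f j))\<^sup>2)"
    have C: "0 \<le> C" by (auto simp: C_def intro: sum_nonneg)
    have G_le: "(cmod (G n))\<^sup>2 \<le> C * corner n" for n
    proof -
      have "cmod (G n) \<le> (\<Sum>j<n0. cmod (f j) * cmod (t j n))"
        unfolding G_def by (rule sum_norm_le) (simp add: norm_mult mult.commute)
      then have "(cmod (G n))\<^sup>2 \<le> (\<Sum>j<n0. cmod (f j) * cmod (t j n))\<^sup>2"
        by (intro power_mono) auto
      also have "\<dots> \<le> C * (\<Sum>j<n0. (cmod (t j n))\<^sup>2)"
        unfolding C_def by (rule Cauchy_Schwarz_ineq_sum)
      also have "\<dots> \<le> C * corner n"
        unfolding corner_def by (intro mult_left_mono C sum_mono) simp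
      finally show ?thesis .
    qed
    have "summable (\<lambda>n. (cmod (y n))\<^sup>2)"
    proof (rule summable_three_term)
      show "0 \<le> C * corner n / (\<alpha>\<^sup>2 * \<eta>)" for n using C corner_nonneg \<eta> by simp
      show "summable (\<lambda>n. C * corner n / (\<alpha>\<^sup>2 * \<eta>))" by (intro summable_divide summable_mult summable_corner)
      show "1 \<le> N" using N by simp
      fix n assume n: "N \<le> n"
      let ?a = "cmod (t (Suc n) n)"
      have a: "0 < ?a" "\<alpha> \<le> ?a" using a_ge[OF n] \<alpha> by auto
      have "cmod (y (Suc n)) = cmod (G n + (t n n - d) * y n + t (n - 1) n * y (n - 1)) / ?a"
        by (simp only: y_Suc[OF n] F_def norm_divide norm_minus_cancel)
      also have "\<dots> \<le> (cmod (G n) + \<eta> * ?a * cmod (y n) + \<theta> * ?a * cmod (y (n - 1))) / ?a"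
      proof (rule divide_right_mono)
        have "cmod (G n + (t n n - d) * y n + t (n - 1) n * y (n - 1)) \<le>
            cmod (G n) + cmod (t n n - d) * cmod (y n) + cmod (t (n - 1) n) * cmod (y (n - 1))"
          by (intro norm_triangle_le add_mono) (simp_all add: norm_mult norm_triangle_ineq)
        also have "\<dots> \<le> cmod (G n) + \<eta> * ?a * cmod (y n) + \<theta> * ?a * cmod (y (n - 1))"
          by (intro add_mono mult_right_mono d_le b_le n) auto
        finally show "cmod (G n + (t n n - d) * y n + t (n - 1) n * y (n - 1)) \<le>
            cmod (G n) + \<eta> * ?a * cmod (y n) + \<theta> * ?a * cmod (y (n - 1))" .
      qed simp
      also have "\<dots> = cmod (G n) / ?a + \<eta> * cmod (y n) + \<theta> * cmod (y (n - 1))"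
        using a by (simp add: field_simps)
      finally have "(cmod (y (Suc n)))\<^sup>2 \<le> (cmod (G n) / ?a + \<eta> * cmod (y n) + \<theta> * cmod (y (n - 1)))\<^sup>2"
        by (intro power_mono) auto
      also have "\<dots> \<le> (cmod (G n) / ?a)\<^sup>2 / \<eta> + \<eta> * (cmod (y n))\<^sup>2 + \<theta> * (cmod (y (n - 1)))\<^sup>2"
        using \<eta> \<theta> by (intro weighted_square_le)
      also have "(cmod (G n) / ?a)\<^sup>2 / \<eta> \<le> C * corner n / \<alpha>\<^sup>2 / \<eta>"
        unfolding power_divide using \<eta> \<alpha> a G_le C corner_nonneg
        by (intro divide_right_mono frac_le power_mono) auto
      finally show "(cmod (y (Suc n)))\<^sup>2 \<le> C * corner n / (\<alpha>\<^sup>2 * \<eta>) + \<eta> * (cmod (y n))\<^sup>2 + \<theta> * (cmod (y (n - 1)))\<^sup>2"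
        by simp
    qed (use \<eta> \<theta> in auto)
    then have sum: "summable (\<lambda>n. (cmod (cnj (y n)))\<^sup>2)" by simp
    define x where "x = (\<Sum>k. cnj (y k) *\<^sub>C e k)"
    have x: "cinner x (e j) = cnj (y j)" for j
      unfolding x_def by (rule cinner_suminf_basis[OF basis sum])
    have "cinner (T (e n) - d *\<^sub>C e n) x = 0" if n: "N \<le> n" for n
    proof -
      have coord: "cinner (T (e n) - d *\<^sub>C e n) (e j) = t j n - (if j = n then d else 0)" for j
        by (simp add: cinner_diff_left cinner_scaleC_left cinner_basis[OF basis] t_def)
      let ?A = "{..<n0} \<union> {n - 1, n, Suc n}"
      have "t j n - (if j = n then d else 0) = 0" if "j \<notin> ?A" for j
      proof -
        have "n0 \<le> j" "j + 2 \<le> n \<or> n + 2 \<le> j" using that by auto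
        then show ?thesis using t_upper[of j n] t_lower[of n j] n N by auto
      qed
      then have "cinner (T (e n) - d *\<^sub>C e n) x = (\<Sum>j\<in>?A. (t j n - (if j = n then d else 0)) * y j)"
        by (subst cinner_finite[OF basis, of ?A]) (simp_all add: coord x)
      also have "\<dots> = (\<Sum>j<n0. (t j n - (if j = n then d else 0)) * y j) +
          (\<Sum>j\<in>{n - 1, n, Suc n}. (t j n - (if j = n then d else 0)) * y j)"
        using n N by (intro sum.union_disjoint) auto
      also have "(\<Sum>j<n0. (t j n - (if j = n then d else 0)) * y j) = G n"
        unfolding G_def using n N by (intro sum.cong) (auto simp: y_init)
      also have "(\<Sum>j\<in>{n - 1, n, Suc n}. (t j n - (if j = n then d else 0)) * y j) =
          t (n - 1) n * y (n - 1) + (t n n - d) * y n + t (Suc n) n * y (Suc n)"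
        using n N by (cases n) auto
      also have "t (Suc n) n * y (Suc n) = - (G n + (t n n - d) * y n + t (n - 1) n * y (n - 1))"
        unfolding y_Suc[OF n] F_def using a_nonzero[OF n] by simp
      finally show ?thesis by simp
    qed
    then show ?thesis using x y_init by (intro exI[of _ x]) auto
  qed
  then show ?thesis by blast
qed

text \<open>The \<open>N + 1\<close> free coordinates outnumber the \<open>N\<close> remaining equations.\<close>

lemma adjoint_eigenvector:
  assumes "0 < suminf defect"
  shows "\<exists>d x. x \<noteq> 0 \<and> (\<forall>y. cinner (T y - d *\<^sub>C y) x = 0)"
proof -
  obtain d where d: "(\<lambda>n. t n n) \<longlonglongrightarrow> d" using convergent_diagonal[OF assms] by blast
  obtain N where N: "\<And>f. \<exists>x. (\<forall>j\<le>N. cinner x (e j) = f j) \<and> (\<forall>n\<ge>N. cinner (T (e n) - d *\<^sub>C e n) x = 0)"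
    using tail_solution[OF assms d] by blast
  \<comment> \<open>One tail solution for each unit choice of the first \<open>N\<close> + 1
    coordinates; their combinations have freely chosen initial coordinates.\<close>
  have "\<forall>k. \<exists>x. (\<forall>j\<le>N. cinner x (e j) = (if j = k then 1 else 0)) \<and>
      (\<forall>n\<ge>N. cinner (T (e n) - d *\<^sub>C e n) x = 0)"
    by (intro allI N)
  then obtain v where v: "\<And>k j. j \<le> N \<Longrightarrow> cinner (v k) (e j) = (if j = k then 1 else 0)"
      "\<And>k n. N \<le> n \<Longrightarrow> cinner (T (e n) - d *\<^sub>C e n) (v k) = 0"
    by metis
  define A where "A n k = cinner (v k) (T (e n) - d *\<^sub>C e n)" for n k
  obtain c where c: "\<exists>k\<in>{..N}. c k \<noteq> 0" "\<forall>n<N. (\<Sum>k\<le>N. c k * A n k) = 0"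
    using homogeneous_system_nontrivial[of "{..N}" N A] by auto
  define x where "x = (\<Sum>k\<le>N. c k *\<^sub>C v k)"
  have "cinner x (e j) = c j" if "j \<le> N" for j
    using that by (simp add: x_def cinner_sum_left cinner_scaleC_left v if_distrib cong: if_cong)
  with c(1) have "x \<noteq> 0" by auto
  have A_tail: "A n k = 0" if "N \<le> n" for n k
    using v(2)[OF that, of k] unfolding A_def by (metis cinner_commute complex_cnj_zero)
  have ortho: "cinner x (T (e n) - d *\<^sub>C e n) = 0" for n
  proof -
    have "cinner x (T (e n) - d *\<^sub>C e n) = (\<Sum>k\<le>N. c k * A n k)"
      by (simp add: x_def cinner_sum_left cinner_scaleC_left A_def)
    then show ?thesis using c(2) A_tail by (cases "n < N") auto
  qed
  \<comment> \<open>The adjoint of \<open>T - d\<close> applied to \<open>x\<close>; orthogonality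
    to every basis vector makes it zero.\<close>
  define w where "w = cadjoint T x - cnj d *\<^sub>C x"
  have w: "cinner w y = cinner x (T y - d *\<^sub>C y)" for y
    by (simp add: w_def cinner_diff_left cinner_diff_right cinner_scaleC_left cinner_scaleC_right
        cinner_cadjoint_left[OF T])
  have "w = 0"
    by (rule orthonormal_basis_total[OF basis]) (simp add: w ortho)
  then have "cinner (T y - d *\<^sub>C y) x = 0" for y
    using w[of y] by (metis cinner_commute cinner_zero_left complex_cnj_zero)
  with \<open>x \<noteq> 0\<close> show ?thesis by blast
qed

end

theorem corollary2p7:
  fixes T :: "'a::chilbert_space \<Rightarrow> 'a" and e :: "nat \<Rightarrow> 'a" and n0 :: nat
  assumes "cinfinite_dimensional TYPE('a)"
    and "separable_space (euclidean :: 'a topology)"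
    and "bounded_clinear T"
    and "hyponormal T"
    and "\<not> (\<exists>c. \<forall>x. T x = c *\<^sub>C x)"
    and "orthonormal_basis e"
    and "\<And>l n. l \<ge> 2 \<Longrightarrow> n \<ge> n0 \<Longrightarrow>
           cinner (T (e n)) (e (n + l)) = 0 \<and> cinner (cadjoint T (e n)) (e (n + l)) = 0"
  shows "\<exists>M. csubspace M \<and> closed M \<and> hyperinvariant T M \<and> M \<noteq> {0} \<and> M \<noteq> UNIV"
proof -
  interpret tridiagonal_hyponormal T e n0
    by unfold_locales (use assms in auto)
  \<comment> \<open>The trace of a positive operator: zero leads to the normal case, a positive
    value to an eigenvector of the adjoint.\<close>
  have "0 \<le> suminf defect"
    by (rule suminf_nonneg[OF summable_defect defect_nonneg])
  then consider "suminf defect = 0" | "0 < suminf defect" by linarith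
  then show ?thesis
  proof cases
    case 1
    then show ?thesis
      by (intro normal_hyperinvariant T normal_if_trace_zero assms(5))
  next
    case 2
    then obtain d x where "x \<noteq> 0" "\<And>y. cinner (T y - d *\<^sub>C y) x = 0"
      using adjoint_eigenvector by blast
    then show ?thesis
      by (intro hyperinvariant_of_adjoint_eigenvector[OF T assms(5)])
  qed
qed

end
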